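(* Let $R$ be an order in a number field $K$ and let $A$ be an $R$-algebra which is free of finite rank as an $R$-module, and let $r=r(A,R)$. If $r_0<r_{\mathfrak p}$ for some maximal ideal $\mathfrak p$ of $R$, then $r=\max\{r_{\mathfrak p}:\mathfrak p\in\operatorname{mSpec}R\}$. If $r_0=r_{\mathfrak p}$ for all maximal ideals $\mathfrak p$, then $r_0\le r\le r_0+1$.
   Context: Algebras are associative and unital. $r(B,S)$ denotes the smallest number of generators of an $S$-algebra $B$ (generation meaning the non-commutative monomials, including $1$, span $B$ as an $S$-module). For a prime ideal $\mathfrak p$ of $R$, $\kappa(\mathfrak p)$ is the fraction field of $R/\mathfrak p$ and $r_{\mathfrak p}=r(A\otimes_R\kappa(\mathfrak p),\kappa(\mathfrak p))$; $r_0=r(A\otimes_RK,K)$. An order in $K$ is a subring of $K$ free of rank $[K:\mathbb Q]$ as a $\mathbb Z$-module. *)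

theory Defs
  imports Complex_Main "HOL-Algebra.QuotRing"
begin

text \<open>A number field is modelled as a type 'k of characteristic 0 which is
finite-dimensional over the rationals; its degree [K:Q] is the length of a Q-basis.\<close>

definition rat_comb :: "rat list \<Rightarrow> 'k::field_char_0 list \<Rightarrow> 'k" where
  "rat_comb qs bs = (\<Sum>i<length bs. of_rat (qs ! i) * bs ! i)"

definition is_Q_basis :: "'k::field_char_0 list \<Rightarrow> bool" where
  "is_Q_basis bs \<longleftrightarrow>
     (\<forall>qs. length qs = length bs \<and> rat_comb qs bs = 0 \<longrightarrow> (\<forall>i<length bs. qs ! i = 0)) \<and>
     (\<forall>x. \<exists>qs. length qs = length bs \<and> x = rat_comb qs bs)"

definition number_field_degree :: "'k::field_char_0 itself \<Rightarrow> nat \<Rightarrow> bool" where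
  "number_field_degree _ d \<longleftrightarrow> (\<exists>bs::'k list. length bs = d \<and> is_Q_basis bs)"

definition is_number_field :: "'k::field_char_0 itself \<Rightarrow> bool" where
  "is_number_field K \<longleftrightarrow> (\<exists>d. number_field_degree K d)"

definition int_comb :: "int list \<Rightarrow> 'k::field_char_0 list \<Rightarrow> 'k" where
  "int_comb zs bs = (\<Sum>i<length bs. of_int (zs ! i) * bs ! i)"

definition is_subring :: "'k::field_char_0 set \<Rightarrow> bool" where
  "is_subring R \<longleftrightarrow> 1 \<in> R \<and> (\<forall>x\<in>R. \<forall>y\<in>R. x + y \<in> R \<and> x - y \<in> R \<and> x * y \<in> R)"

definition Z_free_of_rank :: "'k::field_char_0 set \<Rightarrow> nat \<Rightarrow> bool" where
  "Z_free_of_rank R d \<longleftrightarrow> (\<exists>bs. length bs = d \<and> set bs \<subseteq> R \<and>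
     (\<forall>zs. length zs = length bs \<and> int_comb zs bs = 0 \<longrightarrow> (\<forall>i<length bs. zs ! i = 0)) \<and>
     R = {int_comb zs bs | zs. length zs = length bs})"

definition is_order :: "'k::field_char_0 set \<Rightarrow> bool" where
  "is_order R \<longleftrightarrow> is_subring R \<and> (\<exists>d. number_field_degree TYPE('k) d \<and> Z_free_of_rank R d)"

definition ring_of :: "'a::comm_ring_1 set \<Rightarrow> 'a ring" where
  "ring_of S = \<lparr>carrier = S, mult = (*), one = 1, zero = 0, add = (+)\<rparr>"

text \<open>An S-algebra free of rank n is S^n (vectors v with v i = 0 for i >= n) with the
S-bilinear multiplication e_i e_j = sum_k c i j k e_k and unit e.\<close>

definition sc_vecs :: "('c,'m) ring_scheme \<Rightarrow> nat \<Rightarrow> (nat \<Rightarrow> 'c) set" where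
  "sc_vecs S n = {v. (\<forall>i<n. v i \<in> carrier S) \<and> (\<forall>i\<ge>n. v i = \<zero>\<^bsub>S\<^esub>)}"

definition sc_zero :: "('c,'m) ring_scheme \<Rightarrow> nat \<Rightarrow> 'c" where
  "sc_zero S = (\<lambda>i. \<zero>\<^bsub>S\<^esub>)"

definition sc_add :: "('c,'m) ring_scheme \<Rightarrow> (nat \<Rightarrow> 'c) \<Rightarrow> (nat \<Rightarrow> 'c) \<Rightarrow> nat \<Rightarrow> 'c" where
  "sc_add S u v = (\<lambda>i. u i \<oplus>\<^bsub>S\<^esub> v i)"

definition sc_smult :: "('c,'m) ring_scheme \<Rightarrow> 'c \<Rightarrow> (nat \<Rightarrow> 'c) \<Rightarrow> nat \<Rightarrow> 'c" where
  "sc_smult S a v = (\<lambda>i. a \<otimes>\<^bsub>S\<^esub> v i)"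

definition sc_mul :: "('c,'m) ring_scheme \<Rightarrow> nat \<Rightarrow> (nat \<Rightarrow> nat \<Rightarrow> nat \<Rightarrow> 'c)
    \<Rightarrow> (nat \<Rightarrow> 'c) \<Rightarrow> (nat \<Rightarrow> 'c) \<Rightarrow> nat \<Rightarrow> 'c" where
  "sc_mul S n c u v = (\<lambda>k. if k < n then
      finsum S (\<lambda>i. finsum S (\<lambda>j. u i \<otimes>\<^bsub>S\<^esub> v j \<otimes>\<^bsub>S\<^esub> c i j k) {..<n}) {..<n}
    else \<zero>\<^bsub>S\<^esub>)"

definition sc_algebra :: "('c,'m) ring_scheme \<Rightarrow> nat \<Rightarrow> (nat \<Rightarrow> nat \<Rightarrow> nat \<Rightarrow> 'c) \<Rightarrow> (nat \<Rightarrow> 'c) \<Rightarrow> bool" where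
  "sc_algebra S n c e \<longleftrightarrow>
     (\<forall>i<n. \<forall>j<n. \<forall>k<n. c i j k \<in> carrier S) \<and> e \<in> sc_vecs S n \<and>
     (\<forall>x\<in>sc_vecs S n. \<forall>y\<in>sc_vecs S n. \<forall>z\<in>sc_vecs S n.
        sc_mul S n c (sc_mul S n c x y) z = sc_mul S n c x (sc_mul S n c y z)) \<and>
     (\<forall>x\<in>sc_vecs S n. sc_mul S n c e x = x \<and> sc_mul S n c x e = x)"

definition sc_monomial :: "('c,'m) ring_scheme \<Rightarrow> nat \<Rightarrow> (nat \<Rightarrow> nat \<Rightarrow> nat \<Rightarrow> 'c) \<Rightarrow> (nat \<Rightarrow> 'c)
    \<Rightarrow> (nat \<Rightarrow> 'c) list \<Rightarrow> nat list \<Rightarrow> nat \<Rightarrow> 'c" where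
  "sc_monomial S n c e g w = foldr (\<lambda>i acc. sc_mul S n c (g ! i) acc) w e"

definition sc_span :: "('c,'m) ring_scheme \<Rightarrow> (nat \<Rightarrow> 'c) set \<Rightarrow> (nat \<Rightarrow> 'c) set" where
  "sc_span S M = {v. \<exists>vs as. set vs \<subseteq> M \<and> length as = length vs \<and> set as \<subseteq> carrier S \<and>
      v = foldr (\<lambda>(a, x) acc. sc_add S (sc_smult S a x) acc) (zip as vs) (sc_zero S)}"

definition sc_generates :: "('c,'m) ring_scheme \<Rightarrow> nat \<Rightarrow> (nat \<Rightarrow> nat \<Rightarrow> nat \<Rightarrow> 'c) \<Rightarrow> (nat \<Rightarrow> 'c)
    \<Rightarrow> (nat \<Rightarrow> 'c) list \<Rightarrow> bool" where
  "sc_generates S n c e g \<longleftrightarrow> set g \<subseteq> sc_vecs S n \<and>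
     sc_vecs S n \<subseteq> sc_span S {sc_monomial S n c e g w | w. set w \<subseteq> {..<length g}}"

definition sc_num_gens :: "('c,'m) ring_scheme \<Rightarrow> nat \<Rightarrow> (nat \<Rightarrow> nat \<Rightarrow> nat \<Rightarrow> 'c) \<Rightarrow> (nat \<Rightarrow> 'c) \<Rightarrow> nat" where
  "sc_num_gens S n c e = (LEAST m. \<exists>g. length g = m \<and> sc_generates S n c e g)"

text \<open>For a maximal ideal p of R, kappa(p) = Frac(R/p) = R/p; base change of the structure
constants along R -> R/p.\<close>
definition r_prime :: "'k::field_char_0 set \<Rightarrow> nat \<Rightarrow> (nat \<Rightarrow> nat \<Rightarrow> nat \<Rightarrow> 'k) \<Rightarrow> (nat \<Rightarrow> 'k)
    \<Rightarrow> 'k set \<Rightarrow> nat" where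
  "r_prime R n c e p = sc_num_gens (ring_of R Quot p) n
      (\<lambda>i j k. p +>\<^bsub>ring_of R\<^esub> c i j k) (\<lambda>k. p +>\<^bsub>ring_of R\<^esub> e k)"

text \<open>Base change along R -> K (the whole type 'k).\<close>
definition r_zero :: "nat \<Rightarrow> (nat \<Rightarrow> nat \<Rightarrow> nat \<Rightarrow> 'k::field_char_0) \<Rightarrow> (nat \<Rightarrow> 'k) \<Rightarrow> nat" where
  "r_zero n c e = sc_num_gens (ring_of (UNIV :: 'k set)) n c e"

end

theory Submission
  imports Defs
begin

text \<open>
  For a set \<open>G\<close> of elements of \<open>A = R\<^sup>n\<close> let \<open>I(G)\<close> be the ideal of those \<open>x \<in> R\<close> for which \<open>x A\<close> lies in
  the \<open>R\<close>-subalgebra generated by \<open>G\<close>. Then \<open>G\<close> generates \<open>A\<close> iff \<open>1 \<in> I(G)\<close>, it generates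
  \<open>A \<otimes> R/p\<close> iff \<open>I(G)\<close> is not contained in \<open>p\<close> (Nakayama), and it generates \<open>A \<otimes> K\<close> iff \<open>I(G) \<noteq> 0\<close>.
  In particular \<open>r\<^sub>0 \<le> r\<^sub>p \<le> r\<close>, and it remains to see that \<open>k\<close> elements generate \<open>A\<close> whenever
  \<open>k > r\<^sub>0\<close> and \<open>k \<ge> r\<^sub>p\<close> for all \<open>p\<close>.

  The generators are chosen one at a time, so that the partial list \<open>a\<^sub>1, \<dots>, a\<^sub>j\<close> always extends to
  \<open>k - 1\<close> generators over \<open>K\<close> and, for every maximal ideal \<open>p\<close>, to \<open>k\<close> generators modulo \<open>p\<close>.
  An extension \<open>b\<^sub>j\<^sub>+\<^sub>1, \<dots>, b\<^sub>k\<^sub>-\<^sub>1\<close> over \<open>K\<close>, taken in \<open>A\<close>, works modulo all \<open>p\<close> outside a finite set \<open>P\<close>.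
  By the Chinese remainder theorem there is \<open>a\<^sub>j\<^sub>+\<^sub>1\<close> which is extendable modulo each \<open>p \<in> P\<close> and congruent
  to \<open>b\<^sub>j\<^sub>+\<^sub>1\<close> modulo one further maximal ideal \<open>q \<notin> P\<close>. The latter keeps the list extendable modulo \<open>q\<close>,
  hence over \<open>K\<close>, by \<open>b\<^sub>j\<^sub>+\<^sub>2, \<dots>, b\<^sub>k\<^sub>-\<^sub>1\<close>; modulo any \<open>p \<notin> P\<close> the old extension
  \<open>b\<^sub>j\<^sub>+\<^sub>1, \<dots>, b\<^sub>k\<^sub>-\<^sub>1\<close> still fits, because \<open>k\<close> elements are allowed there. After \<open>k - 1\<close> steps only finitely
  many \<open>p\<close> are left, and the last generator is found by the Chinese remainder theorem.
\<close>

section \<open>Generation of algebras given by structure constants\<close>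

text \<open>Monomials and linear combinations are recast inductively over sets of generators. This
  replaces index words and coefficient lists by rule induction, and monotonicity in the generators
  becomes immediate.\<close>

inductive_set sc_mons :: "('c,'m) ring_scheme \<Rightarrow> nat \<Rightarrow> (nat \<Rightarrow> nat \<Rightarrow> nat \<Rightarrow> 'c) \<Rightarrow> (nat \<Rightarrow> 'c)
    \<Rightarrow> (nat \<Rightarrow> 'c) set \<Rightarrow> (nat \<Rightarrow> 'c) set"
  for S n c e G where
  unit: "e \<in> sc_mons S n c e G"
| mul: "x \<in> G \<Longrightarrow> m \<in> sc_mons S n c e G \<Longrightarrow> sc_mul S n c x m \<in> sc_mons S n c e G"

inductive_set sc_lin :: "('c,'m) ring_scheme \<Rightarrow> (nat \<Rightarrow> 'c) set \<Rightarrow> (nat \<Rightarrow> 'c) set"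
  for S X where
  zero: "sc_zero S \<in> sc_lin S X"
| step: "a \<in> carrier S \<Longrightarrow> x \<in> X \<Longrightarrow> v \<in> sc_lin S X \<Longrightarrow> sc_add S (sc_smult S a x) v \<in> sc_lin S X"

definition sc_generated_by :: "('c,'m) ring_scheme \<Rightarrow> nat \<Rightarrow> (nat \<Rightarrow> nat \<Rightarrow> nat \<Rightarrow> 'c) \<Rightarrow> (nat \<Rightarrow> 'c)
    \<Rightarrow> (nat \<Rightarrow> 'c) set \<Rightarrow> bool" where
  "sc_generated_by S n c e G \<longleftrightarrow>
     G \<subseteq> sc_vecs S n \<and> sc_vecs S n \<subseteq> sc_lin S (sc_mons S n c e G)"

lemma sc_mons_mono: "G \<subseteq> H \<Longrightarrow> sc_mons S n c e G \<subseteq> sc_mons S n c e H"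
proof
  fix x assume "G \<subseteq> H" "x \<in> sc_mons S n c e G"
  from this(2,1) show "x \<in> sc_mons S n c e H"
    by induction (auto intro: sc_mons.intros)
qed

lemma sc_lin_mono: "X \<subseteq> Y \<Longrightarrow> sc_lin S X \<subseteq> sc_lin S Y"
proof
  fix x assume "X \<subseteq> Y" "x \<in> sc_lin S X"
  from this(2,1) show "x \<in> sc_lin S Y"
    by induction (auto intro: sc_lin.intros)
qed

lemma sc_span_eq_sc_lin: "sc_span S X = sc_lin S X"
proof (intro equalityI subsetI)
  fix v assume "v \<in> sc_span S X"
  then obtain vs as where *: "set vs \<subseteq> X" "length as = length vs" "set as \<subseteq> carrier S"
    and v: "v = foldr (\<lambda>(a, x) acc. sc_add S (sc_smult S a x) acc) (zip as vs) (sc_zero S)"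
    unfolding sc_span_def by blast
  from *(2,1,3) show "v \<in> sc_lin S X"
    unfolding v by (induction as vs rule: list_induct2) (auto intro: sc_lin.intros)
next
  fix v assume "v \<in> sc_lin S X"
  then show "v \<in> sc_span S X"
  proof induction
    case zero
    show ?case unfolding sc_span_def by (intro CollectI exI[of _ "[]"]) simp
  next
    case (step a x v)
    then obtain vs as where *: "set vs \<subseteq> X" "length as = length vs" "set as \<subseteq> carrier S"
      "v = foldr (\<lambda>(a, x) acc. sc_add S (sc_smult S a x) acc) (zip as vs) (sc_zero S)"
      unfolding sc_span_def by blast
    with step(1,2) show ?case unfolding sc_span_def
      by (intro CollectI exI[of _ "x # vs"] exI[of _ "a # as"]) simp
  qed
qed

lemma sc_monomials_eq_sc_mons:
  "{sc_monomial S n c e g w | w. set w \<subseteq> {..<length g}} = sc_mons S n c e (set g)"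
proof (intro equalityI subsetI)
  fix v assume "v \<in> {sc_monomial S n c e g w | w. set w \<subseteq> {..<length g}}"
  then obtain w where v: "v = sc_monomial S n c e g w" and w: "set w \<subseteq> {..<length g}" by blast
  from w show "v \<in> sc_mons S n c e (set g)"
    unfolding v sc_monomial_def by (induction w) (auto intro: sc_mons.intros)
next
  fix v assume "v \<in> sc_mons S n c e (set g)"
  then show "v \<in> {sc_monomial S n c e g w | w. set w \<subseteq> {..<length g}}"
  proof induction
    case unit
    show ?case by (intro CollectI exI[of _ "[]"]) (simp add: sc_monomial_def)
  next
    case (mul x m)
    then obtain w i where "m = sc_monomial S n c e g w" "set w \<subseteq> {..<length g}"
      "i < length g" "x = g ! i" by (auto simp: in_set_conv_nth)
    then show ?case
      by (intro CollectI exI[of _ "i # w"]) (simp add: sc_monomial_def)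
  qed
qed

lemma sc_generates_iff: "sc_generates S n c e g \<longleftrightarrow> sc_generated_by S n c e (set g)"
  by (simp add: sc_generates_def sc_generated_by_def sc_span_eq_sc_lin sc_monomials_eq_sc_mons)

lemma sc_generated_by_mono:
  assumes "sc_generated_by S n c e G" "G \<subseteq> H" "H \<subseteq> sc_vecs S n"
  shows "sc_generated_by S n c e H"
  using assms sc_lin_mono[OF sc_mons_mono[OF assms(2)]] unfolding sc_generated_by_def by blast

text \<open>The hypothesis guarantees that the \<open>LEAST\<close> in the definition is attained.
  Repetitions in a list only make its set smaller, and a finite set can be listed without
  repetition, so lists of length \<open>k\<close> may be traded for sets of at most \<open>k\<close>
  elements.\<close>

lemma sc_num_gens_le_iff:
  assumes ex: "\<exists>G. finite G \<and> sc_generated_by S n c e G"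
  shows "sc_num_gens S n c e \<le> k \<longleftrightarrow>
           (\<exists>G. finite G \<and> card G \<le> k \<and> sc_generated_by S n c e G)"
proof
  have "\<exists>m g. length g = m \<and> sc_generates S n c e g"
    using ex finite_list unfolding sc_generates_iff by metis
  then have "\<exists>g. length g = sc_num_gens S n c e \<and> sc_generates S n c e g"
    unfolding sc_num_gens_def by (rule LeastI_ex)
  then obtain g where g: "length g = sc_num_gens S n c e" "sc_generates S n c e g"
    by blast
  assume "sc_num_gens S n c e \<le> k"
  then have "card (set g) \<le> k"
    using g(1) card_length[of g] by linarith
  then show "\<exists>G. finite G \<and> card G \<le> k \<and> sc_generated_by S n c e G"
    using g(2) sc_generates_iff by blast
next
  assume "\<exists>G. finite G \<and> card G \<le> k \<and> sc_generated_by S n c e G"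
  then obtain G where G: "finite G" "card G \<le> k" "sc_generated_by S n c e G" by blast
  obtain g where g: "set g = G" "distinct g" using finite_distinct_list[OF G(1)] by blast
  then have "length g \<le> k" using distinct_card[OF g(2)] G(2) by simp
  moreover have "sc_generates S n c e g" using g G(3) by (simp add: sc_generates_iff)
  then have "sc_num_gens S n c e \<le> length g"
    unfolding sc_num_gens_def by (intro Least_le) blast
  ultimately show "sc_num_gens S n c e \<le> k" by linarith
qed

section \<open>Base change of structure constants along ring homomorphisms\<close>

lemma sc_mul_closed:
  assumes "cring S" "\<forall>i<n. \<forall>j<n. \<forall>k<n. c i j k \<in> carrier S"
    "u \<in> sc_vecs S n" "v \<in> sc_vecs S n"
  shows "sc_mul S n c u v \<in> sc_vecs S n"
proof -
  interpret cring S by fact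
  show ?thesis using assms unfolding sc_vecs_def sc_mul_def
    by (auto intro!: finsum_closed)
qed

lemma sc_mons_subset_vecs:
  assumes "cring S" "\<forall>i<n. \<forall>j<n. \<forall>k<n. c i j k \<in> carrier S" "e \<in> sc_vecs S n" "G \<subseteq> sc_vecs S n"
  shows "sc_mons S n c e G \<subseteq> sc_vecs S n"
proof
  fix m assume "m \<in> sc_mons S n c e G"
  then show "m \<in> sc_vecs S n"
    by induction (use assms in \<open>auto intro: sc_mul_closed\<close>)
qed

lemma sc_lin_subset_vecs:
  assumes "ring S" "X \<subseteq> sc_vecs S n"
  shows "sc_lin S X \<subseteq> sc_vecs S n"
proof
  interpret ring S by fact
  fix m assume "m \<in> sc_lin S X"
  then show "m \<in> sc_vecs S n"
    by induction (use assms in \<open>auto simp: sc_vecs_def sc_zero_def sc_add_def sc_smult_def\<close>)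
qed

text \<open>The product is polynomial in the coordinates and the structure constants, so a ring
  homomorphism applied to each coordinate respects it.\<close>

lemma sc_mul_hom:
  assumes "ring_hom_cring S T f" "\<forall>i<n. \<forall>j<n. \<forall>k<n. c i j k \<in> carrier S"
    "u \<in> sc_vecs S n" "v \<in> sc_vecs S n"
  shows "sc_mul T n (\<lambda>i j k. f (c i j k)) (f \<circ> u) (f \<circ> v) = f \<circ> sc_mul S n c u v"
proof
  interpret ring_hom_cring S T f by fact
  fix k
  show "sc_mul T n (\<lambda>i j k. f (c i j k)) (f \<circ> u) (f \<circ> v) k = (f \<circ> sc_mul S n c u v) k"
  proof (cases "k < n")
    case True
    have [simp]: "i < n \<Longrightarrow> u i \<in> carrier S" "i < n \<Longrightarrow> v i \<in> carrier S" for i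
      using assms(3,4) by (auto simp: sc_vecs_def)
    have "(f \<circ> sc_mul S n c u v) k =
      f (finsum S (\<lambda>i. finsum S (\<lambda>j. u i \<otimes>\<^bsub>S\<^esub> v j \<otimes>\<^bsub>S\<^esub> c i j k) {..<n}) {..<n})"
      using True by (simp add: sc_mul_def)
    also have "\<dots> = finsum T (\<lambda>i. f (finsum S (\<lambda>j. u i \<otimes>\<^bsub>S\<^esub> v j \<otimes>\<^bsub>S\<^esub> c i j k) {..<n})) {..<n}"
      using assms(2) True
      by (subst hom_finsum) (auto intro!: R.finsum_closed simp: comp_def)
    also have "\<dots> = finsum T (\<lambda>i. finsum T (\<lambda>j. f (u i) \<otimes>\<^bsub>T\<^esub> f (v j) \<otimes>\<^bsub>T\<^esub> f (c i j k)) {..<n}) {..<n}"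
    proof (rule S.finsum_cong'[OF refl])
      show "(\<lambda>i. finsum T (\<lambda>j. f (u i) \<otimes>\<^bsub>T\<^esub> f (v j) \<otimes>\<^bsub>T\<^esub> f (c i j k)) {..<n}) \<in> {..<n} \<rightarrow> carrier T"
        using assms(2) True by (auto intro!: S.finsum_closed)
      fix i assume i: "i \<in> {..<n}"
      have "f (finsum S (\<lambda>j. u i \<otimes>\<^bsub>S\<^esub> v j \<otimes>\<^bsub>S\<^esub> c i j k) {..<n}) =
          finsum T (\<lambda>j. f (u i \<otimes>\<^bsub>S\<^esub> v j \<otimes>\<^bsub>S\<^esub> c i j k)) {..<n}"
        using assms(2) True i by (subst hom_finsum) (auto simp: comp_def)
      also have "\<dots> = finsum T (\<lambda>j. f (u i) \<otimes>\<^bsub>T\<^esub> f (v j) \<otimes>\<^bsub>T\<^esub> f (c i j k)) {..<n}"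
        using assms(2) True i by (intro S.finsum_cong') auto
      finally show "f (finsum S (\<lambda>j. u i \<otimes>\<^bsub>S\<^esub> v j \<otimes>\<^bsub>S\<^esub> c i j k) {..<n}) =
        finsum T (\<lambda>j. f (u i) \<otimes>\<^bsub>T\<^esub> f (v j) \<otimes>\<^bsub>T\<^esub> f (c i j k)) {..<n}" .
    qed
    finally show ?thesis using True by (simp add: sc_mul_def)
  qed (simp add: sc_mul_def)
qed

lemma sc_mons_hom:
  assumes hom: "ring_hom_cring S T f" and c: "\<forall>i<n. \<forall>j<n. \<forall>k<n. c i j k \<in> carrier S"
    and e: "e \<in> sc_vecs S n" and G: "G \<subseteq> sc_vecs S n"
  shows "sc_mons T n (\<lambda>i j k. f (c i j k)) (f \<circ> e) ((\<circ>) f ` G) = (\<circ>) f ` sc_mons S n c e G"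
proof -
  interpret ring_hom_cring S T f by fact
  have sub: "sc_mons S n c e G \<subseteq> sc_vecs S n"
    by (rule sc_mons_subset_vecs) (use c e G R.is_cring in auto)
  show ?thesis
  proof (intro equalityI subsetI)
    fix v assume "v \<in> sc_mons T n (\<lambda>i j k. f (c i j k)) (f \<circ> e) ((\<circ>) f ` G)"
    then show "v \<in> (\<circ>) f ` sc_mons S n c e G"
    proof induction
      case unit
      show ?case by (intro imageI sc_mons.unit)
    next
      case (mul x m)
      then obtain x' m' where "x' \<in> G" "m' \<in> sc_mons S n c e G" "x = f \<circ> x'" "m = f \<circ> m'" by blast
      moreover from this have "sc_mul T n (\<lambda>i j k. f (c i j k)) x m = f \<circ> sc_mul S n c x' m'"
        using sc_mul_hom[OF hom c, of x' m'] sub G by auto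
      ultimately show ?case by (auto intro: sc_mons.mul)
    qed
  next
    fix v assume "v \<in> (\<circ>) f ` sc_mons S n c e G"
    then obtain m where v: "v = f \<circ> m" and "m \<in> sc_mons S n c e G" by blast
    from this(2) show "v \<in> sc_mons T n (\<lambda>i j k. f (c i j k)) (f \<circ> e) ((\<circ>) f ` G)"
      unfolding v
    proof induction
      case unit
      show ?case by (rule sc_mons.unit)
    next
      case (mul x m)
      then have "f \<circ> sc_mul S n c x m = sc_mul T n (\<lambda>i j k. f (c i j k)) (f \<circ> x) (f \<circ> m)"
        using sc_mul_hom[OF hom c, of x m, symmetric] sub G by blast
      with mul show ?case by (simp only:) (blast intro: sc_mons.mul)
    qed
  qed
qed

lemma sc_lin_step_hom:
  assumes "ring_hom_cring S T f" "\<forall>i. x i \<in> carrier S" "\<forall>i. v i \<in> carrier S" "a \<in> carrier S"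
  shows "sc_add T (sc_smult T (f a) (f \<circ> x)) (f \<circ> v) = f \<circ> sc_add S (sc_smult S a x) v"
proof -
  interpret ring_hom_cring S T f by fact
  show ?thesis using assms by (auto simp: sc_add_def sc_smult_def fun_eq_iff)
qed

text \<open>Surjectivity is what allows the coefficients from \<open>T\<close> to be lifted to
  \<open>S\<close>.\<close>

lemma sc_lin_hom:
  assumes hom: "ring_hom_cring S T f" and surj: "f ` carrier S = carrier T"
    and X: "X \<subseteq> sc_vecs S n"
  shows "sc_lin T ((\<circ>) f ` X) = (\<circ>) f ` sc_lin S X"
proof -
  interpret ring_hom_cring S T f by fact
  have sub: "sc_lin S X \<subseteq> sc_vecs S n" by (rule sc_lin_subset_vecs) (use X R.ring_axioms in auto)
  have carr: "v i \<in> carrier S" if "v \<in> sc_vecs S n" for v i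
    using that by (cases "i < n") (auto simp: sc_vecs_def)
  have z: "sc_zero T = f \<circ> sc_zero S" by (auto simp: sc_zero_def)
  show ?thesis
  proof (intro equalityI subsetI)
    fix v assume "v \<in> sc_lin T ((\<circ>) f ` X)"
    then show "v \<in> (\<circ>) f ` sc_lin S X"
    proof induction
      case zero
      show ?case unfolding z by (intro imageI sc_lin.zero)
    next
      case (step a x v)
      then obtain a' x' v' where *: "a' \<in> carrier S" "x' \<in> X" "v' \<in> sc_lin S X"
        "a = f a'" "x = f \<circ> x'" "v = f \<circ> v'" unfolding surj[symmetric] by blast
      have "sc_add T (sc_smult T a x) v = f \<circ> sc_add S (sc_smult S a' x') v'"
        unfolding *(4-6) using *(1-3) X sub carr by (intro sc_lin_step_hom[OF hom]) blast+
      with * show ?case by (auto intro: sc_lin.step)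
    qed
  next
    fix v assume "v \<in> (\<circ>) f ` sc_lin S X"
    then obtain m where v: "v = f \<circ> m" and "m \<in> sc_lin S X" by blast
    from this(2) show "v \<in> sc_lin T ((\<circ>) f ` X)"
      unfolding v
    proof induction
      case zero
      show ?case unfolding z[symmetric] by (rule sc_lin.zero)
    next
      case (step a x v)
      have "sc_add T (sc_smult T (f a) (f \<circ> x)) (f \<circ> v) = f \<circ> sc_add S (sc_smult S a x) v"
        using step X sub carr by (intro sc_lin_step_hom[OF hom]) blast+
      moreover have "sc_add T (sc_smult T (f a) (f \<circ> x)) (f \<circ> v) \<in> sc_lin T ((\<circ>) f ` X)"
        using step by (intro sc_lin.step hom_closed imageI)
      ultimately show ?case by (simp only:)
    qed
  qed
qed

lemma sc_vecs_hom:
  assumes hom: "ring_hom_cring S T f" and surj: "f ` carrier S = carrier T"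
  shows "sc_vecs T n = (\<circ>) f ` sc_vecs S n"
proof -
  interpret ring_hom_cring S T f by fact
  show ?thesis
  proof (intro equalityI subsetI)
    fix v assume v: "v \<in> sc_vecs T n"
    then have "\<forall>i. \<exists>a. i < n \<longrightarrow> a \<in> carrier S \<and> f a = v i"
      unfolding sc_vecs_def surj[symmetric] by (auto simp: image_iff) metis
    then obtain u where u: "\<And>i. i < n \<Longrightarrow> u i \<in> carrier S \<and> f (u i) = v i" by metis
    have "v = f \<circ> (\<lambda>i. if i < n then u i else \<zero>\<^bsub>S\<^esub>)"
      using u v by (auto simp: sc_vecs_def fun_eq_iff)
    moreover have "(\<lambda>i. if i < n then u i else \<zero>\<^bsub>S\<^esub>) \<in> sc_vecs S n"
      using u by (auto simp: sc_vecs_def)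
    ultimately show "v \<in> (\<circ>) f ` sc_vecs S n" by blast
  qed (auto simp: sc_vecs_def)
qed

text \<open>Monomials, their span and the full module over \<open>T\<close> are all images of those
  over \<open>S\<close>. Generation over \<open>T\<close> thus becomes a statement about vectors
  over \<open>S\<close> up to the kernel of \<open>f\<close>.\<close>

lemma sc_generated_by_hom_iff:
  assumes hom: "ring_hom_cring S T f" and surj: "f ` carrier S = carrier T"
    and c: "\<forall>i<n. \<forall>j<n. \<forall>k<n. c i j k \<in> carrier S"
    and e: "e \<in> sc_vecs S n" and G: "G \<subseteq> sc_vecs S n"
  shows "sc_generated_by T n (\<lambda>i j k. f (c i j k)) (f \<circ> e) ((\<circ>) f ` G) \<longleftrightarrow>
    (\<forall>v\<in>sc_vecs S n. \<exists>m\<in>sc_lin S (sc_mons S n c e G). f \<circ> v = f \<circ> m)"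
proof -
  interpret ring_hom_cring S T f by fact
  have "sc_mons S n c e G \<subseteq> sc_vecs S n"
    by (rule sc_mons_subset_vecs) (use c e G R.is_cring in auto)
  then show ?thesis
    unfolding sc_generated_by_def sc_mons_hom[OF hom c e G] sc_vecs_hom[OF hom surj]
    using G by (subst sc_lin_hom[OF hom surj]) (auto simp: image_subset_iff image_iff)
qed

section \<open>Ideals of a subring of a field\<close>

lemma ring_of_simps [simp]:
  "carrier (ring_of S) = S" "mult (ring_of S) = (*)" "one (ring_of S) = 1"
  "zero (ring_of S) = 0" "add (ring_of S) = (+)"
  by (simp_all add: ring_of_def)

lemma is_subringD:
  assumes "is_subring R"
  shows "1 \<in> R" "0 \<in> R" "x \<in> R \<Longrightarrow> y \<in> R \<Longrightarrow> x + y \<in> R" "x \<in> R \<Longrightarrow> y \<in> R \<Longrightarrow> x - y \<in> R"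
    "x \<in> R \<Longrightarrow> y \<in> R \<Longrightarrow> x * y \<in> R" "x \<in> R \<Longrightarrow> - x \<in> R"
proof -
  show one: "1 \<in> R" and diff: "x \<in> R \<Longrightarrow> y \<in> R \<Longrightarrow> x - y \<in> R" for x y
    using assms by (auto simp: is_subring_def)
  show zero: "0 \<in> R" using diff[OF one one] by simp
  show "x \<in> R \<Longrightarrow> - x \<in> R" using diff[OF zero, of x] by simp
qed (use assms in \<open>auto simp: is_subring_def\<close>)

lemma is_subring_sum: "is_subring R \<Longrightarrow> (\<And>i. i \<in> A \<Longrightarrow> f i \<in> R) \<Longrightarrow> sum f A \<in> R"
  by (induction A rule: infinite_finite_induct) (auto intro: is_subringD)

lemma is_subring_of_int: "is_subring R \<Longrightarrow> of_int z \<in> R"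
proof (induction z rule: int_induct[where k = 0])
  case base then show ?case by (simp add: is_subringD)
next
  case (step1 i) then show ?case by (auto intro: is_subringD)
next
  case (step2 i) then show ?case by (auto intro: is_subringD)
qed

lemma cring_ring_of:
  fixes R :: "'k::field_char_0 set"
  assumes "is_subring R"
  shows "cring (ring_of R)"
proof (rule cringI)
  note R = is_subringD[OF assms]
  show "abelian_group (ring_of R)"
  proof (rule abelian_groupI)
    fix x assume "x \<in> carrier (ring_of R)"
    then show "\<exists>y\<in>carrier (ring_of R). y \<oplus>\<^bsub>ring_of R\<^esub> x = \<zero>\<^bsub>ring_of R\<^esub>"
      by (intro bexI[of _ "- x"]) (auto intro: R)
  qed (auto intro: R simp: algebra_simps)
  show "comm_monoid (ring_of R)"
    by (rule comm_monoidI) (auto intro: R simp: algebra_simps)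
qed (auto simp: algebra_simps)

lemma finsum_ring_of:
  assumes "is_subring R" "\<And>i. i \<in> A \<Longrightarrow> f i \<in> R" "finite A"
  shows "finsum (ring_of R) f A = sum f A"
proof -
  interpret cring "ring_of R" by (rule cring_ring_of) fact
  from assms(3,2) show ?thesis
    by (induction A) auto
qed

definition ring_ideal :: "'k::field_char_0 set \<Rightarrow> 'k set \<Rightarrow> bool" where
  "ring_ideal R I \<longleftrightarrow> I \<subseteq> R \<and> 0 \<in> I \<and> (\<forall>x\<in>I. \<forall>y\<in>I. x + y \<in> I) \<and> (\<forall>a\<in>R. \<forall>x\<in>I. a * x \<in> I)"

lemma ring_idealD:
  assumes "ring_ideal R I"
  shows "x \<in> I \<Longrightarrow> x \<in> R" "0 \<in> I" "x \<in> I \<Longrightarrow> y \<in> I \<Longrightarrow> x + y \<in> I" "a \<in> R \<Longrightarrow> x \<in> I \<Longrightarrow> a * x \<in> I"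
    "a \<in> R \<Longrightarrow> x \<in> I \<Longrightarrow> x * a \<in> I"
  using assms by (auto simp: ring_ideal_def mult.commute)

lemma ring_ideal_diff:
  assumes "is_subring R" "ring_ideal R I" "x \<in> I" "y \<in> I"
  shows "- x \<in> I" "x - y \<in> I"
proof -
  have neg: "- z \<in> I" if "z \<in> I" for z
    using ring_idealD(4)[OF assms(2), of "- 1" z] is_subringD(1,6)[OF assms(1)] that by auto
  then show "- x \<in> I" using assms by blast
  show "x - y \<in> I" using ring_idealD(3)[OF assms(2,3) neg[OF assms(4)]] by simp
qed

lemma ring_ideal_sum:
  "ring_ideal R I \<Longrightarrow> (\<And>i. i \<in> A \<Longrightarrow> f i \<in> I) \<Longrightarrow> sum f A \<in> I"
  by (induction A rule: infinite_finite_induct) (auto intro: ring_idealD)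

lemma ideal_ring_of_iff:
  assumes "is_subring R"
  shows "ideal I (ring_of R) \<longleftrightarrow> ring_ideal R I"
proof
  interpret cring "ring_of R" by (rule cring_ring_of) fact
  {
    assume "ideal I (ring_of R)"
    then interpret ideal I "ring_of R" .
    show "ring_ideal R I"
      using a_subset zero_closed a_closed I_l_closed unfolding ring_ideal_def by simp
  }
  assume I: "ring_ideal R I"
  note D = ring_idealD[OF I]
  show "ideal I (ring_of R)"
  proof (rule idealI)
    show "subgroup I (add_monoid (ring_of R))"
    proof (rule add.subgroupI)
      fix a assume a: "a \<in> I"
      have "\<ominus>\<^bsub>ring_of R\<^esub> a = - a"
        using a by (intro minus_equality) (auto intro: D(1) is_subringD(6)[OF assms])
      then show "\<ominus>\<^bsub>ring_of R\<^esub> a \<in> I"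
        using ring_ideal_diff[OF assms I a a] by simp
    qed (use D(2) in \<open>auto intro: D(1,3)\<close>)
  qed (auto intro: D(4,5) ring_axioms)
qed

text \<open>The third claim is that \<open>R/p\<close> is a field, phrased without forming the
  quotient: the ideal \<open>p + x R\<close> is strictly larger than \<open>p\<close>, hence
  contains 1.\<close>

lemma maximalideal_ring_idealD:
  assumes "is_subring R" "maximalideal p (ring_of R)"
  shows "ring_ideal R p" "1 \<notin> p" "x \<in> R \<Longrightarrow> x \<notin> p \<Longrightarrow> \<exists>y\<in>R. x * y - 1 \<in> p"
proof -
  interpret maximalideal p "ring_of R" by fact
  show p: "ring_ideal R p" using ideal_axioms ideal_ring_of_iff[OF assms(1)] by blast
  note R = is_subringD[OF assms(1)] and D = ring_idealD[OF p]
  show one: "1 \<notin> p" using one_imp_carrier I_notcarr by auto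
  assume x: "x \<in> R" "x \<notin> p"
  let ?J = "{a + x * y | a y. a \<in> p \<and> y \<in> R}"
  have "ring_ideal R ?J"
    unfolding ring_ideal_def
  proof (intro conjI ballI)
    show "?J \<subseteq> R" using x(1) by (auto intro: R(3,5) D(1))
    show "0 \<in> ?J" using R(2) D(2) by (intro CollectI exI[of _ 0] exI[of _ 0]) simp
  next
    fix u v assume "u \<in> ?J" "v \<in> ?J"
    then obtain a y b z where "a \<in> p" "y \<in> R" "b \<in> p" "z \<in> R" "u = a + x * y" "v = b + x * z" by blast
    then show "u + v \<in> ?J"
      by (intro CollectI exI[of _ "a + b"] exI[of _ "y + z"]) (auto simp: algebra_simps intro: R(3) D(3))
  next
    fix r u assume r: "r \<in> R" and "u \<in> ?J"
    then obtain a y where "a \<in> p" "y \<in> R" "u = a + x * y" by blast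
    then show "r * u \<in> ?J"
      using r by (intro CollectI exI[of _ "r * a"] exI[of _ "r * y"])
        (auto simp: distrib_left mult.left_commute intro: R(5) D(4))
  qed
  moreover from this have "?J \<subseteq> R" by (auto simp: ring_ideal_def)
  moreover have "p \<subseteq> ?J"
  proof
    fix a assume "a \<in> p"
    then show "a \<in> ?J" using R(2) by (intro CollectI exI[of _ a] exI[of _ 0]) auto
  qed
  ultimately have "?J = p \<or> ?J = R"
    using I_maximal[of ?J] ideal_ring_of_iff[OF assms(1)] by simp
  moreover have "x \<in> ?J" using R(1) D(2) by (intro CollectI exI[of _ 0] exI[of _ 1]) auto
  ultimately have "1 \<in> ?J" using x R(1) by blast
  then obtain a y where "a \<in> p" "y \<in> R" "1 = a + x * y" by blast
  then have "x * y - 1 = - a" by (auto simp: algebra_simps)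
  then show "\<exists>y\<in>R. x * y - 1 \<in> p"
    using ring_ideal_diff(1)[OF assms(1) p \<open>a \<in> p\<close> \<open>a \<in> p\<close>] \<open>y \<in> R\<close>
    by (intro bexI[of _ y]) (simp_all only:)
qed

section \<open>Existence of maximal ideals and the Chinese remainder theorem\<close>

text \<open>Zorn's lemma is applied to the ideals that contain \<open>I\<close> and avoid 1; this
  property passes to the union of a nonempty chain.\<close>

lemma exists_maximalideal:
  fixes R :: "'k::field_char_0 set"
  assumes R: "is_subring R" and I: "ring_ideal R I" "1 \<notin> I"
  obtains p where "maximalideal p (ring_of R)" "I \<subseteq> p"
proof -
  let ?A = "{J. ring_ideal R J \<and> 1 \<notin> J \<and> I \<subseteq> J}"
  have "\<exists>M\<in>?A. \<forall>X\<in>?A. M \<subseteq> X \<longrightarrow> X = M"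
  proof (rule subset_Zorn_nonempty)
    show "?A \<noteq> {}" using I by blast
    fix C assume C: "C \<noteq> {}" "subset.chain ?A C"
    then have CA: "C \<subseteq> ?A" and lin: "\<And>X Y. X \<in> C \<Longrightarrow> Y \<in> C \<Longrightarrow> X \<subseteq> Y \<or> Y \<subseteq> X"
      by (auto simp: subset.chain_def)
    have "ring_ideal R (\<Union>C)"
      unfolding ring_ideal_def
    proof (intro conjI ballI)
      show "\<Union>C \<subseteq> R" using CA by (auto simp: ring_ideal_def)
      obtain X where "X \<in> C" using C(1) by blast
      then show "0 \<in> \<Union>C" using CA by (auto simp: ring_ideal_def)
    next
      fix x y assume "x \<in> \<Union>C" "y \<in> \<Union>C"
      then obtain X where "X \<in> C" "x \<in> X" "y \<in> X" using lin by blast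
      then show "x + y \<in> \<Union>C" using CA by (intro UnionI[of X]) (auto simp: ring_ideal_def)
    next
      fix a x assume "a \<in> R" "x \<in> \<Union>C"
      then obtain X where "X \<in> C" "x \<in> X" by blast
      with \<open>a \<in> R\<close> show "a * x \<in> \<Union>C" using CA by (intro UnionI[of X]) (auto simp: ring_ideal_def)
    qed
    then show "\<Union>C \<in> ?A" using CA C(1) by auto
  qed
  then obtain p where "p \<in> ?A" and max': "\<forall>X\<in>?A. p \<subseteq> X \<longrightarrow> X = p" by (elim bexE)
  then have p: "ring_ideal R p" "1 \<notin> p" "I \<subseteq> p" by auto
  have max: "X = p" if "ring_ideal R X" "1 \<notin> X" "p \<subseteq> X" for X
    using that p(3) by (intro max'[rule_format] CollectI) auto
  have "maximalideal p (ring_of R)"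
  proof (rule maximalidealI)
    show "ideal p (ring_of R)" using p ideal_ring_of_iff[OF R] by blast
    show "carrier (ring_of R) \<noteq> p" using p is_subringD(1)[OF R] by auto
    fix J assume J: "ideal J (ring_of R)" "p \<subseteq> J" "J \<subseteq> carrier (ring_of R)"
    then have JI: "ring_ideal R J" using ideal_ring_of_iff[OF R] by blast
    show "J = p \<or> J = carrier (ring_of R)"
    proof (cases "1 \<in> J")
      case True
      then have "a \<in> J" if "a \<in> R" for a using ring_idealD(4)[OF JI that True] by simp
      then show ?thesis using J by auto
    qed (use max[OF JI] J in simp)
  qed
  then show thesis using p(3) by (rule that)
qed

text \<open>For each \<open>p\<close> in \<open>P\<close> there is an element of \<open>p\<close>
  that is 1 modulo \<open>q\<close>; the product of these elements is as required.\<close>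

lemma maximalideal_separating:
  assumes R: "is_subring R" and q: "maximalideal q (ring_of R)"
    and "finite P" "\<And>p. p \<in> P \<Longrightarrow> maximalideal p (ring_of R)" "q \<notin> P"
  shows "\<exists>x\<in>R. x - 1 \<in> q \<and> (\<forall>p\<in>P. x \<in> p)"
  using assms(3-5)
proof (induction P)
  case empty
  show ?case using is_subringD(1)[OF R] ring_idealD(2)[OF maximalideal_ring_idealD(1)[OF R q]]
    by (intro bexI[of _ 1]) auto
next
  case (insert p P)
  then obtain x where x: "x \<in> R" "x - 1 \<in> q" "\<forall>p\<in>P. x \<in> p" by auto
  have p: "maximalideal p (ring_of R)" using insert by blast
  note q' = maximalideal_ring_idealD[OF R q] and p' = maximalideal_ring_idealD[OF R p]
  \<comment> \<open>Distinct maximal ideals are not nested: an element of \<open>q\<close> outside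
    \<open>p\<close> is invertible modulo \<open>p\<close>, and with \<open>p\<close> inside
    \<open>q\<close> this would put 1 into \<open>q\<close>.\<close>
  have "\<not> p \<subseteq> q"
  proof
    assume "p \<subseteq> q"
    moreover have "p \<noteq> q" using insert by blast
    ultimately obtain z where z: "z \<in> q" "z \<notin> p" by blast
    then obtain y where "y \<in> R" "z * y - 1 \<in> p" using p'(3) ring_idealD(1)[OF q'(1)] by blast
    then have "z * y - (z * y - 1) \<in> q"
      using z \<open>p \<subseteq> q\<close> by (blast intro: ring_ideal_diff(2)[OF R q'(1)] ring_idealD(5)[OF q'(1)])
    then show False using q'(2) by simp
  qed
  then obtain z where z: "z \<in> p" "z \<notin> q" by blast
  have zR: "z \<in> R" using z ring_idealD(1)[OF p'(1)] by blast
  then obtain y where y: "y \<in> R" "z * y - 1 \<in> q" using q'(3) z by blast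
  \<comment> \<open>The factor \<open>z * y\<close> lies in \<open>p\<close> and is 1 modulo
    \<open>q\<close>, while \<open>x\<close> takes care of the remaining members of
    \<open>P\<close>.\<close>
  let ?x = "x * (z * y)"
  have "?x \<in> R" using x(1) y(1) zR by (intro is_subringD(5)[OF R])
  moreover have "x * (z * y - 1) + (x - 1) \<in> q"
    using x y by (intro ring_idealD(3,4)[OF q'(1)])
  then have "?x - 1 \<in> q" by (simp add: algebra_simps)
  moreover have "?x \<in> p'" if "p' \<in> insert p P" for p'
  proof -
    have *: "ring_ideal R p'" using maximalideal_ring_idealD(1)[OF R] insert that by blast
    show ?thesis
    proof (cases "p' = p")
      case True
      then show ?thesis using ring_idealD(4)[OF * x(1)] ring_idealD(5)[OF * y(1)] z(1) by blast
    next
      case False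
      then have "x \<in> p'" using that x(3) by blast
      then show ?thesis using ring_idealD(5)[OF *] is_subringD(5)[OF R zR y(1)] by blast
    qed
  qed
  ultimately show ?case by blast
qed

text \<open>The separating elements \<open>x p\<close> act as idempotents modulo the members of
  \<open>P\<close>, so the sum of the \<open>x p * t p\<close> has the prescribed residues in all
  coordinates at once.\<close>

lemma maximalideal_crt:
  fixes t :: "'k::field_char_0 set \<Rightarrow> nat \<Rightarrow> 'k"
  assumes R: "is_subring R" and P: "finite P" "\<And>p. p \<in> P \<Longrightarrow> maximalideal p (ring_of R)"
    and t: "\<And>p. p \<in> P \<Longrightarrow> t p \<in> sc_vecs (ring_of R) n"
  shows "\<exists>u\<in>sc_vecs (ring_of R) n. \<forall>p\<in>P. \<forall>i<n. u i - t p i \<in> p"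
proof -
  note RD = is_subringD[OF R]
  have "\<forall>p. \<exists>x. p \<in> P \<longrightarrow> x \<in> R \<and> x - 1 \<in> p \<and> (\<forall>p'\<in>P - {p}. x \<in> p')"
  proof
    fix p
    show "\<exists>x. p \<in> P \<longrightarrow> x \<in> R \<and> x - 1 \<in> p \<and> (\<forall>p'\<in>P - {p}. x \<in> p')"
      using maximalideal_separating[OF R P(2), of p "P - {p}"] P by (cases "p \<in> P") auto
  qed
  from choice[OF this] obtain x where
    x': "\<forall>p. p \<in> P \<longrightarrow> x p \<in> R \<and> x p - 1 \<in> p \<and> (\<forall>p'\<in>P - {p}. x p \<in> p')" ..
  have x: "x p \<in> R" "x p - 1 \<in> p" if "p \<in> P" for p using x' that by auto
  have x3: "x p' \<in> p" if "p' \<in> P - {p}" "p \<in> P" for p p' using x' that by auto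
  let ?u = "\<lambda>i. \<Sum>p\<in>P. x p * t p i"
  have "?u \<in> sc_vecs (ring_of R) n"
    using t x(1) unfolding sc_vecs_def by (auto intro!: is_subring_sum[OF R] RD(5))
  moreover have "?u i - t p i \<in> p" if "p \<in> P" "i < n" for p i
  proof -
    have p: "ring_ideal R p" using maximalideal_ring_idealD(1)[OF R] P that by blast
    have tR: "t p' i \<in> R" if "p' \<in> P" for p' using t[OF that] \<open>i < n\<close> by (auto simp: sc_vecs_def)
    have "?u i - t p i = (x p - 1) * t p i + (\<Sum>p'\<in>P - {p}. x p' * t p' i)"
      using that P(1) by (simp add: sum.remove[of P p] algebra_simps)
    also have "\<dots> \<in> p"
    proof (rule ring_idealD(3)[OF p])
      show "(x p - 1) * t p i \<in> p" by (intro ring_idealD(5)[OF p] tR x that)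
      show "(\<Sum>p'\<in>P - {p}. x p' * t p' i) \<in> p"
      proof (rule ring_ideal_sum[OF p])
        fix p' assume p': "p' \<in> P - {p}"
        then show "x p' * t p' i \<in> p"
          by (intro ring_idealD(5)[OF p] tR x3 that) auto
      qed
    qed
    finally show ?thesis .
  qed
  ultimately show ?thesis by (intro bexI[of _ ?u] ballI allI impI)
qed

section \<open>Orders in number fields\<close>

lemma common_denominator:
  fixes q :: "'i \<Rightarrow> rat"
  assumes "finite A"
  obtains D :: int and z where "D \<noteq> 0" "\<And>i. i \<in> A \<Longrightarrow> of_int D * q i = of_int (z i)"
proof -
  define D where "D = (\<Prod>i\<in>A. snd (quotient_of (q i)))"
  have D: "D \<noteq> 0" unfolding D_def
    using quotient_of_denom_pos' assms by (auto simp: prod_zero_iff) (metis less_irrefl)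
  have "\<exists>z. of_int D * q i = of_int z" if "i \<in> A" for i
  proof -
    obtain a b where ab: "quotient_of (q i) = (a, b)" by force
    have "snd (quotient_of (q i)) dvd D" unfolding D_def using that assms by (rule dvd_prodI[rotated])
    then obtain k where k: "D = b * k" unfolding ab by auto
    have "q i = of_int a / of_int b" "b \<noteq> 0"
      using quotient_of_div[OF ab] quotient_of_denom_pos[OF ab] by auto
    then have "of_int D * q i = of_int (k * a)" by (simp add: k)
    then show ?thesis by blast
  qed
  then have "\<exists>z. \<forall>i\<in>A. of_int D * q i = of_int (z i)" by (intro bchoice) blast
  then show thesis using D that by blast
qed

lemma int_comb_eq_rat_comb:
  fixes bs :: "'k::field_char_0 list"
  assumes "\<And>i. i < length bs \<Longrightarrow> of_int D * (qs ! i) = of_int (z i)"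
  shows "int_comb (map z [0..<length bs]) bs = of_int D * rat_comb qs bs"
  unfolding int_comb_def rat_comb_def sum_distrib_left
proof (rule sum.cong[OF refl])
  fix i assume i: "i \<in> {..<length bs}"
  have "(of_int (z i) :: 'k) = of_rat (of_int D * (qs ! i))"
    using assms[of i] i by simp
  also have "\<dots> = of_int D * of_rat (qs ! i)" by (simp add: of_rat_mult)
  finally show "of_int (map z [0..<length bs] ! i) * bs ! i = of_int D * (of_rat (qs ! i) * bs ! i)"
    using i by simp
qed

text \<open>A \<open>\<int>\<close>-basis of \<open>R\<close> is independent over the rationals and
  has as many elements as the degree of the field, so it is also a basis of the field. Clearing
  denominators in the coordinates of \<open>x\<close> gives \<open>N\<close>.\<close>

lemma is_order_fraction:
  fixes R :: "'k::field_char_0 set"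
  assumes "is_order R"
  shows "\<exists>N::int. N \<noteq> 0 \<and> of_int N * x \<in> R"
proof -
  obtain d bs0 where bs0: "length bs0 = d" "is_Q_basis (bs0::'k list)" and Z: "Z_free_of_rank R d"
    using assms unfolding is_order_def number_field_degree_def by blast
  obtain bs where bs: "length bs = d" "set bs \<subseteq> R"
    and indep: "\<And>zs. length zs = length bs \<Longrightarrow> int_comb zs bs = 0 \<Longrightarrow> (\<forall>i<length bs. zs ! i = 0)"
    and RB: "R = {int_comb zs bs | zs. length zs = length bs}"
    using Z unfolding Z_free_of_rank_def by blast
  \<comment> \<open>Multiplying a rational relation by a common denominator gives an integral
    one.\<close>
  have indepQ: "\<forall>i<length bs. qs ! i = 0"
    if len: "length qs = length bs" and comb: "rat_comb qs bs = 0" for qs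
  proof -
    obtain D z where D: "D \<noteq> 0" and z: "\<And>i. i < length bs \<Longrightarrow> of_int D * (qs ! i) = of_int (z i)"
      using common_denominator[of "{..<length bs}" "(!) qs"] by auto
    have "int_comb (map z [0..<length bs]) bs = of_int D * rat_comb qs bs"
      by (rule int_comb_eq_rat_comb) (use z len in auto)
    then have "\<forall>i<length bs. z i = 0" using indep[of "map z [0..<length bs]"] comb by simp
    then show ?thesis using z D by fastforce
  qed
  \<comment> \<open>The definitions speak of lists, dimension theory of sets;
    \<open>distinct_indep\<close> and \<open>span_comb\<close> translate between the two.\<close>
  interpret Q: vector_space "\<lambda>q (x::'k). of_rat q * x"
    by unfold_locales (auto simp: algebra_simps of_rat_add of_rat_mult)
  have distinct_indep: "distinct l \<and> Q.independent (set l)"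
    if l: "\<And>qs. length qs = length l \<Longrightarrow> rat_comb qs l = 0 \<Longrightarrow> (\<forall>i<length l. qs ! i = 0)" for l :: "'k list"
  proof
    show dist: "distinct l"
      unfolding distinct_conv_nth
    proof (intro allI impI notI)
      fix i j assume ij: "i < length l" "j < length l" "i \<noteq> j" "l ! i = l ! j"
      \<comment> \<open>Equal entries at positions \<open>i\<close> and \<open>j\<close> would give
        this nontrivial relation.\<close>
      let ?qs = "map (\<lambda>k. if k = i then 1 else if k = j then - 1 else 0) [0..<length l]"
      have "rat_comb ?qs l = (\<Sum>k<length l. (if k = i then l ! i else 0) - (if k = j then l ! j else 0))"
        unfolding rat_comb_def using ij by (intro sum.cong) auto
      also have "\<dots> = 0" using ij by (simp add: sum_subtractf)
      finally show False using l[of ?qs] ij by fastforce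
    qed
    show "Q.independent (set l)"
    proof (rule Q.independent_if_scalars_zero)
      fix f x assume f: "(\<Sum>x\<in>set l. of_rat (f x) * x) = 0" and x: "x \<in> set l"
      have "rat_comb (map f l) l = (\<Sum>i<length l. of_rat (f (l ! i)) * l ! i)"
        by (simp add: rat_comb_def)
      also have "\<dots> = (\<Sum>x\<in>set l. of_rat (f x) * x)"
        by (rule sum.reindex_bij_betw[OF bij_betw_nth[OF dist refl refl]])
      finally show "f x = 0" using l[of "map f l"] f x by (auto simp: in_set_conv_nth)
    qed simp
  qed
  have span_comb: "\<exists>qs. length qs = length l \<and> y = rat_comb qs l" if "distinct l" "y \<in> Q.span (set l)" for l y
  proof -
    have "y \<in> range (\<lambda>f. \<Sum>x\<in>set l. of_rat (f x) * x)"
      using that(2) unfolding Q.span_finite[OF finite_set] .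
    then obtain f where "y = (\<Sum>x\<in>set l. of_rat (f x) * x)" by blast
    also have "\<dots> = (\<Sum>i<length l. of_rat (f (l ! i)) * l ! i)"
      by (rule sum.reindex_bij_betw[OF bij_betw_nth[OF that(1) refl refl], symmetric])
    finally show ?thesis by (intro exI[of _ "map f l"]) (simp add: rat_comb_def)
  qed
  have d0: "distinct bs0" "Q.independent (set bs0)"
    using distinct_indep[of bs0] bs0(2) unfolding is_Q_basis_def by auto
  have d1: "distinct bs" "Q.independent (set bs)"
    using distinct_indep[OF indepQ] by auto
  have span0: "Q.span (set bs0) = UNIV"
  proof (intro equalityI subsetI UNIV_I)
    fix y
    obtain qs where y: "y = rat_comb qs bs0"
      using bs0(2) unfolding is_Q_basis_def by blast
    show "y \<in> Q.span (set bs0)"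
      unfolding y rat_comb_def by (intro Q.span_sum Q.span_scale Q.span_base) simp
  qed
  interpret Q: finite_dimensional_vector_space "\<lambda>q (x::'k). of_rat q * x" "set bs0"
    using d0 span0 by unfold_locales auto
  have "Q.dim UNIV = card (set bs0)"
    by (rule Q.dim_unique) (use d0 span0 in auto)
  \<comment> \<open>As many independent vectors as the dimension must span.\<close>
  then have "UNIV \<subseteq> Q.span (set bs)"
    using d0 d1 bs0 bs by (intro Q.card_ge_dim_independent) (auto simp: distinct_card)
  then obtain qs where qs: "length qs = length bs" "x = rat_comb qs bs"
    using span_comb[OF d1(1), of x] by blast
  obtain D z where D: "D \<noteq> 0" and z: "\<And>i. i < length bs \<Longrightarrow> of_int D * (qs ! i) = of_int (z i)"
    using common_denominator[of "{..<length bs}" "(!) qs"] by auto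
  have "int_comb (map z [0..<length bs]) bs = of_int D * x"
    unfolding qs(2) by (rule int_comb_eq_rat_comb) (use z qs in auto)
  moreover have "int_comb (map z [0..<length bs]) bs \<in> R"
    unfolding RB by (intro CollectI exI[of _ "map z [0..<length bs]"]) simp
  ultimately show ?thesis using D by auto
qed

lemma is_order_fractions:
  fixes R :: "'k::field_char_0 set"
  assumes R: "is_order R" and "finite A"
  shows "\<exists>N::int. N \<noteq> 0 \<and> (\<forall>x\<in>A. of_int N * x \<in> R)"
  using assms(2)
proof (induction A)
  case empty
  show ?case by (intro exI[of _ 1]) simp
next
  case (insert x A)
  then obtain N where N: "N \<noteq> 0" "\<forall>x\<in>A. of_int N * x \<in> R" by blast
  obtain M where M: "M \<noteq> 0" "of_int M * x \<in> R" using is_order_fraction[OF R] by blast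
  have R': "is_subring R" using R by (simp add: is_order_def)
  have "of_int (N * M) * y \<in> R" if "y \<in> insert x A" for y
  proof (cases "y = x")
    case True
    then have "of_int (N * M) * y = of_int N * (of_int M * x)" by simp
    then show ?thesis using M(2) is_subringD(5)[OF R'] is_subring_of_int[OF R'] by metis
  next
    case False
    then have "of_int N * y \<in> R" using N that by blast
    moreover have "of_int (N * M) * y = of_int M * (of_int N * y)" by simp
    ultimately show ?thesis using is_subringD(5)[OF R'] is_subring_of_int[OF R'] by metis
  qed
  then show ?case using N(1) M(1) by (intro exI[of _ "N * M"]) simp
qed

text \<open>This takes the place of the norm: a nonzero \<open>d\<close> divides a positive integer
  in \<open>R\<close>, found by clearing the denominator of its inverse.\<close>

lemma is_order_int_multiple:
  fixes R :: "'k::field_char_0 set"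
  assumes R: "is_order R" and d: "d \<in> R" "d \<noteq> 0"
  obtains N :: nat and y where "N > 0" "y \<in> R" "of_nat N = d * y"
proof -
  have R': "is_subring R" using R by (simp add: is_order_def)
  obtain M where M: "M \<noteq> 0" "of_int M * inverse d \<in> R" using is_order_fraction[OF R] by blast
  \<comment> \<open>Multiplication by the sign makes the integer positive.\<close>
  have "of_int (sgn M) * (of_int M * inverse d) \<in> R"
    using is_subringD(5)[OF R' is_subring_of_int[OF R'] M(2)] by blast
  moreover have "of_int (sgn M) * (of_int M * inverse d) = of_nat (nat \<bar>M\<bar>) * inverse d"
  proof -
    have "sgn M * M = int (nat \<bar>M\<bar>)" by (simp add: sgn_if)
    then have "(of_int (sgn M * M) :: 'k) = of_int (int (nat \<bar>M\<bar>))" by (simp only:)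
    then have "(of_int (sgn M) :: 'k) * of_int M = of_nat (nat \<bar>M\<bar>)"
      by (simp only: of_int_mult of_int_of_nat_eq)
    then show ?thesis by (simp only: mult.assoc[symmetric])
  qed
  ultimately have "of_nat (nat \<bar>M\<bar>) * inverse d \<in> R" by simp
  then show thesis using M(1) d by (intro that[of "nat \<bar>M\<bar>" "of_nat (nat \<bar>M\<bar>) * inverse d"]) auto
qed

text \<open>Such an ideal contains a positive integer \<open>N\<close> divisible by
  \<open>d\<close>, and \<open>R/NR\<close> is finite because \<open>R\<close> is finitely generated
  over the integers.\<close>

lemma finite_maximalideals_containing:
  fixes R :: "'k::field_char_0 set"
  assumes R: "is_order R" and d: "d \<in> R" "d \<noteq> 0"
  shows "finite {p. maximalideal p (ring_of R) \<and> d \<in> p}"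
proof -
  have R': "is_subring R" using R by (simp add: is_order_def)
  obtain bs where bs: "set bs \<subseteq> R" and RB: "R = {int_comb zs bs | zs. length zs = length bs}"
    using R unfolding is_order_def Z_free_of_rank_def by blast
  obtain N :: nat and y where N: "N > 0" "y \<in> R" "of_nat N = d * y"
    using is_order_int_multiple[OF R d] .
  define F where "F = (\<lambda>zs. int_comb zs bs) ` {zs. set zs \<subseteq> {0..<int N} \<and> length zs = length bs}"
  have finF: "finite F"
    unfolding F_def by (intro finite_imageI finite_lists_length_eq) simp
  \<comment> \<open>An ideal containing N is a union of cosets of N R, so it is determined by its
    intersection with the finite set F of coset representatives.\<close>
  have "inj_on (\<lambda>p. p \<inter> F) {p. maximalideal p (ring_of R) \<and> d \<in> p}"
  proof (rule inj_onI)
    have sub: "p \<subseteq> q" if p: "maximalideal p (ring_of R)" "d \<in> p" and q: "maximalideal q (ring_of R)" "d \<in> q"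
      and eq: "p \<inter> F = q \<inter> F" for p q
    proof
      note p' = maximalideal_ring_idealD(1)[OF R' p(1)] and q' = maximalideal_ring_idealD(1)[OF R' q(1)]
      have Np: "of_nat N \<in> p" "of_nat N \<in> q"
        unfolding N(3) using p q N(2) ring_idealD(5)[OF p'] ring_idealD(5)[OF q'] by auto
      fix x assume x: "x \<in> p"
      then have "x \<in> R" using ring_idealD(1)[OF p'] by blast
      then obtain zs where zs: "length zs = length bs" "x = int_comb zs bs" using RB by blast
      \<comment> \<open>Division with remainder in every coordinate splits \<open>x\<close> into a
        representative \<open>?y\<close> from \<open>F\<close> and a multiple of
        \<open>N\<close>.\<close>
      let ?y = "int_comb (map (\<lambda>z. z mod int N) zs) bs" and ?w = "int_comb (map (\<lambda>z. z div int N) zs) bs"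
      have "?y + of_nat N * ?w = (\<Sum>i<length bs. (of_int (zs ! i mod int N) + of_nat N * of_int (zs ! i div int N)) * bs ! i)"
        unfolding int_comb_def sum_distrib_left sum.distrib[symmetric]
        using zs(1) by (intro sum.cong) (auto simp: algebra_simps)
      also have "\<dots> = x"
        unfolding zs(2) int_comb_def
      proof (rule sum.cong[OF refl])
        fix i
        have "of_int (zs ! i mod int N) + of_nat N * of_int (zs ! i div int N) = (of_int (zs ! i mod int N + int N * (zs ! i div int N)) :: 'k)"
          by (simp only: of_int_add of_int_mult of_int_of_nat_eq)
        then show "(of_int (zs ! i mod int N) + of_nat N * of_int (zs ! i div int N)) * bs ! i = of_int (zs ! i) * bs ! i"
          by simp
      qed
      finally have xyw: "x = ?y + of_nat N * ?w" ..
      have w: "?w \<in> R" unfolding RB by (intro CollectI exI[of _ "map (\<lambda>z. z div int N) zs"]) (simp add: zs)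
      have Nw: "of_nat N * ?w \<in> p" "of_nat N * ?w \<in> q"
        using w Np by (auto intro: ring_idealD(5)[OF p'] ring_idealD(5)[OF q'])
      have "?y = x - of_nat N * ?w" using xyw by simp
      then have "?y \<in> p" using ring_ideal_diff(2)[OF R' p' x Nw(1)] by simp
      moreover have "?y \<in> F" unfolding F_def using N(1) zs(1) by (intro imageI) auto
      ultimately have "?y \<in> q" using eq by blast
      then show "x \<in> q" unfolding xyw using ring_idealD(3)[OF q' _ Nw(2)] by blast
    qed
    fix p q assume "p \<in> {p. maximalideal p (ring_of R) \<and> d \<in> p}" "q \<in> {p. maximalideal p (ring_of R) \<and> d \<in> p}"
      "p \<inter> F = q \<inter> F"
    then show "p = q" using sub[of p q] sub[of q p] by simp
  qed
  moreover have "finite ((\<lambda>p. p \<inter> F) ` {p. maximalideal p (ring_of R) \<and> d \<in> p})"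
    by (rule finite_subset[of _ "Pow F"]) (use finF in auto)
  ultimately show ?thesis by (rule finite_imageD[rotated])
qed

text \<open>This is Euclid's argument: \<open>d\<close> divides some \<open>N > 0\<close>, and a
  maximal ideal containing \<open>N + 1\<close> cannot contain \<open>N\<close>. Such an ideal
  exists because \<open>N + 1\<close> is not a unit of \<open>R\<close>.\<close>

lemma exists_maximalideal_avoiding:
  fixes R :: "'k::field_char_0 set"
  assumes R: "is_order R" and d: "d \<in> R" "d \<noteq> 0"
  obtains q where "maximalideal q (ring_of R)" "d \<notin> q"
proof -
  have R': "is_subring R" using R by (simp add: is_order_def)
  note RD = is_subringD[OF R']
  obtain bs where bs: "set bs \<subseteq> R"
    and indep: "\<forall>zs. length zs = length bs \<and> int_comb zs bs = 0 \<longrightarrow> (\<forall>i<length bs. zs ! i = 0)"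
    and RB: "R = {int_comb zs bs | zs. length zs = length bs}"
    using R unfolding is_order_def Z_free_of_rank_def by blast
  have "bs \<noteq> []"
  proof
    assume "bs = []"
    then have "R = {0}" unfolding RB by (auto simp: int_comb_def)
    then show False using RD(1) by simp
  qed
  obtain N :: nat and y where N: "N > 0" "y \<in> R" "of_nat N = d * y"
    using is_order_int_multiple[OF R d] .
  let ?I = "(\<lambda>r. of_int (int N + 1) * r) ` R"
  have "ring_ideal R ?I"
    unfolding ring_ideal_def
  proof (intro conjI ballI)
    show "?I \<subseteq> R" using RD(5)[OF is_subring_of_int[OF R']] by blast
    show "0 \<in> ?I" by (rule image_eqI[of _ _ 0]) (use RD(2) in auto)
  next
    fix u v assume "u \<in> ?I" "v \<in> ?I"
    then obtain u' v' where uv: "u' \<in> R" "v' \<in> R" "u = of_int (int N + 1) * u'" "v = of_int (int N + 1) * v'" by blast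
    show "u + v \<in> ?I"
      by (rule image_eqI[of _ _ "u' + v'"]) (use uv RD(3) in \<open>auto simp: algebra_simps\<close>)
  next
    fix a v assume "a \<in> R" "v \<in> ?I"
    then obtain v' where v: "v' \<in> R" "v = of_int (int N + 1) * v'" by blast
    show "a * v \<in> ?I"
      by (rule image_eqI[of _ _ "a * v'"]) (use v \<open>a \<in> R\<close> RD(5) in \<open>auto simp: algebra_simps\<close>)
  qed
  moreover have "1 \<notin> ?I"
  proof
    assume "1 \<in> ?I"
    then obtain u where u: "u \<in> R" "1 = of_int (int N + 1) * u" by blast
    have b: "bs ! 0 \<in> R" using bs \<open>bs \<noteq> []\<close> by auto
    then have "u * bs ! 0 \<in> R" using u(1) RD(5) by blast
    then obtain zs where zs: "length zs = length bs" "u * bs ! 0 = int_comb zs bs" using RB by blast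
    \<comment> \<open>If \<open>u\<close> were an inverse of \<open>N + 1\<close>, these would be
      the coordinates of \<open>(N + 1) * u * bs ! 0 - bs ! 0 = 0\<close>; the first one shows that
      \<open>N + 1\<close> divides 1 in the integers.\<close>
    let ?zs = "map (\<lambda>i. (int N + 1) * zs ! i - (if i = 0 then 1 else 0)) [0..<length bs]"
    have "int_comb ?zs bs = (\<Sum>i<length bs. of_int (int N + 1) * (of_int (zs ! i) * bs ! i) - (if i = 0 then bs ! 0 else 0))"
      unfolding int_comb_def by (intro sum.cong) (auto simp: algebra_simps)
    also have "\<dots> = of_int (int N + 1) * int_comb zs bs - bs ! 0"
      using \<open>bs \<noteq> []\<close> by (simp add: sum_subtractf sum_distrib_left int_comb_def)
    also have "\<dots> = (of_int (int N + 1) * u) * bs ! 0 - bs ! 0" unfolding zs(2)[symmetric] by (simp only: mult.assoc)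
    also have "\<dots> = 0" unfolding u(2)[symmetric] by simp
    finally have "?zs ! 0 = 0" using indep[rule_format, of ?zs 0] \<open>bs \<noteq> []\<close> by auto
    then have "(int N + 1) * zs ! 0 = 1" using \<open>bs \<noteq> []\<close> by simp
    then show False using N(1) by (auto simp: zmult_eq_1_iff)
  qed
  ultimately obtain q where q: "maximalideal q (ring_of R)" "?I \<subseteq> q"
    using exists_maximalideal[OF R'] by metis
  note q' = maximalideal_ring_idealD[OF R' q(1)]
  have "d \<notin> q"
  proof
    assume "d \<in> q"
    then have "of_nat N \<in> q" unfolding N(3) using ring_idealD(5)[OF q'(1) N(2)] by blast
    moreover have "of_int (int N + 1) \<in> q"
      using q(2) RD(1) by (auto intro: subsetD[OF q(2)] image_eqI[of _ _ 1])
    ultimately have "of_int (int N + 1) - of_nat N \<in> q" by (intro ring_ideal_diff(2)[OF R' q'(1)])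
    then show False using q'(2) by simp
  qed
  then show thesis using q(1) by (rule that[rotated])
qed

section \<open>Linear combinations over a subring\<close>

lemma sc_vecs_ring_of: "sc_vecs (ring_of S) n = {v. (\<forall>i<n. v i \<in> S) \<and> (\<forall>i\<ge>n. v i = 0)}"
  by (simp add: sc_vecs_def)

lemma sc_lin_ring_of_add:
  "u \<in> sc_lin (ring_of S) X \<Longrightarrow> v \<in> sc_lin (ring_of S) X \<Longrightarrow> (\<lambda>i. u i + v i) \<in> sc_lin (ring_of S) X"
proof (induction u rule: sc_lin.induct)
  case zero
  then show ?case by (simp add: sc_zero_def)
next
  case (step a x u)
  from sc_lin.step[OF step(1,2) step.IH[OF step.prems]] show ?case
    by (simp add: sc_add_def sc_smult_def add.assoc)
qed

lemma sc_lin_ring_of_smult: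
  assumes "is_subring S" "b \<in> S" "u \<in> sc_lin (ring_of S) X"
  shows "(\<lambda>i. b * u i) \<in> sc_lin (ring_of S) X"
  using assms(3)
proof (induction u rule: sc_lin.induct)
  case zero
  show ?case using sc_lin.zero[of "ring_of S" X] by (simp add: sc_zero_def)
next
  case (step a x u)
  have "b * a \<in> carrier (ring_of S)" using assms step(1) by (simp add: is_subringD)
  from sc_lin.step[OF this step(2) step.IH] show ?case
    by (simp add: sc_add_def sc_smult_def algebra_simps)
qed

lemma sc_lin_ring_of_base:
  assumes "is_subring S" "x \<in> X"
  shows "x \<in> sc_lin (ring_of S) X"
proof -
  have "1 \<in> carrier (ring_of S)" using assms is_subringD(1) by simp
  from sc_lin.step[OF this assms(2) sc_lin.zero] show ?thesis
    by (simp add: sc_add_def sc_smult_def sc_zero_def)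
qed

lemma sc_lin_ring_of_sum:
  assumes "finite A" "\<And>a. a \<in> A \<Longrightarrow> f a \<in> sc_lin (ring_of S) X"
  shows "(\<lambda>i. \<Sum>a\<in>A. f a i) \<in> sc_lin (ring_of S) X"
  using assms
proof (induction A)
  case empty
  show ?case using sc_lin.zero[of "ring_of S" X] by (simp add: sc_zero_def)
next
  case (insert a A)
  then show ?case using sc_lin_ring_of_add[of "f a" S X] by simp
qed

lemma sc_mul_ring_of:
  assumes S: "is_subring S" and c: "\<forall>i<n. \<forall>j<n. \<forall>k<n. c i j k \<in> S"
    and u: "u \<in> sc_vecs (ring_of S) n" and v: "v \<in> sc_vecs (ring_of S) n"
  shows "sc_mul (ring_of S) n c u v = (\<lambda>k. if k < n then \<Sum>i<n. \<Sum>j<n. u i * v j * c i j k else 0)"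
proof
  fix k
  have mem: "u i * v j * c i j k \<in> S" if "i < n" "j < n" "k < n" for i j
    using that u v c unfolding sc_vecs_ring_of by (intro is_subringD(5)[OF S]) auto
  have "finsum (ring_of S) (\<lambda>j. u i * v j * c i j k) {..<n} = (\<Sum>j<n. u i * v j * c i j k)"
    if "i < n" "k < n" for i
    using mem that by (intro finsum_ring_of[OF S]) auto
  moreover from this have "finsum (ring_of S) (\<lambda>i. finsum (ring_of S) (\<lambda>j. u i * v j * c i j k) {..<n}) {..<n} =
      (\<Sum>i<n. finsum (ring_of S) (\<lambda>j. u i * v j * c i j k) {..<n})" if "k < n"
    using mem that by (intro finsum_ring_of[OF S]) (auto intro!: is_subring_sum[OF S])
  ultimately show "sc_mul (ring_of S) n c u v k =
      (if k < n then \<Sum>i<n. \<Sum>j<n. u i * v j * c i j k else 0)"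
    by (auto simp: sc_mul_def)
qed

lemma coset_ring_of_eq_iff:
  assumes R: "is_subring R" and p: "ring_ideal R p"
  shows "p +>\<^bsub>ring_of R\<^esub> a = p +>\<^bsub>ring_of R\<^esub> b \<longleftrightarrow> a - b \<in> p"
proof -
  have coset: "p +>\<^bsub>ring_of R\<^esub> x = {h + x | h. h \<in> p}" for x
    by (auto simp: a_r_coset_def r_coset_def)
  have sub: "{h + a | h. h \<in> p} \<subseteq> {h + b | h. h \<in> p}" if "a - b \<in> p" for a b
  proof
    fix x assume "x \<in> {h + a | h. h \<in> p}"
    then obtain h where "h \<in> p" "x = h + a" by blast
    with that show "x \<in> {h + b | h. h \<in> p}"
      using ring_idealD(3)[OF p] by (intro CollectI exI[of _ "h + (a - b)"]) auto
  qed
  show ?thesis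
  proof
    assume "p +>\<^bsub>ring_of R\<^esub> a = p +>\<^bsub>ring_of R\<^esub> b"
    moreover have "a \<in> {h + a | h. h \<in> p}" using ring_idealD(2)[OF p] by force
    ultimately have "a \<in> {h + b | h. h \<in> p}" unfolding coset by simp
    then show "a - b \<in> p" by auto
  next
    assume ab: "a - b \<in> p"
    then have "b - a \<in> p" using ring_ideal_diff(1)[OF R p ab ab] by simp
    with ab show "p +>\<^bsub>ring_of R\<^esub> a = p +>\<^bsub>ring_of R\<^esub> b"
      unfolding coset using sub by (intro equalityI) auto
  qed
qed

text \<open>Nakayama's lemma by elimination: the relations \<open>u i b i \<in> M + \<Sum>j. p b j\<close> with
  \<open>u i \<equiv> 1\<close> modulo \<open>p\<close> are solved for the last \<open>b m\<close>, which is then substituted into the others.\<close>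

lemma nakayama_elimination:
  fixes b :: "nat \<Rightarrow> nat \<Rightarrow> 'k::field_char_0"
  assumes R: "is_subring R" and p: "ring_ideal R p"
    and add: "\<And>v w. v \<in> M \<Longrightarrow> w \<in> M \<Longrightarrow> (\<lambda>k. v k + w k) \<in> M"
    and smult: "\<And>r v. r \<in> R \<Longrightarrow> v \<in> M \<Longrightarrow> (\<lambda>k. r * v k) \<in> M"
    and rel: "\<And>i. i < m \<Longrightarrow> \<exists>u\<in>R. u - 1 \<in> p \<and> (\<exists>w\<in>M. \<exists>a. (\<forall>j<m. a j \<in> p) \<and>
                (\<forall>k. u * b i k = w k + (\<Sum>j<m. a j * b j k)))"
  shows "\<exists>x\<in>R. x - 1 \<in> p \<and> (\<forall>i<m. (\<lambda>k. x * b i k) \<in> M)"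
  using rel
proof (induction m)
  case 0
  show ?case using is_subringD(1)[OF R] ring_idealD(2)[OF p] by (intro bexI[of _ 1]) auto
next
  case (Suc m)
  note RD = is_subringD[OF R] and pD = ring_idealD[OF p]
  obtain u w a where u: "u \<in> R" "u - 1 \<in> p" and w: "w \<in> M" and a: "\<And>j. j < Suc m \<Longrightarrow> a j \<in> p"
    and eq: "\<And>k. u * b m k = w k + (\<Sum>j<Suc m. a j * b j k)"
    using Suc.prems[of m] by blast
  \<comment> \<open>The term \<open>a m * b m\<close> in the relation for \<open>b m\<close> is
    moved to the left. Since \<open>a m\<close> lies in \<open>p\<close>, the new coefficient is
    still 1 modulo \<open>p\<close>.\<close>
  define v where "v = u - a m"
  have am: "a m \<in> p" using a by simp
  have vR: "v \<in> R" unfolding v_def using u(1) am pD(1) by (intro RD(4))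
  have prod1: "x * y - 1 \<in> p" if "x \<in> R" "x - 1 \<in> p" "y - 1 \<in> p" for x y
  proof -
    have "x * (y - 1) + (x - 1) \<in> p" by (intro pD(3,4) that)
    then show ?thesis by (simp add: algebra_simps)
  qed
  have v1: "v - 1 \<in> p"
  proof -
    have "(u - 1) - a m \<in> p" by (rule ring_ideal_diff(2)[OF R p u(2) am])
    then show ?thesis by (simp add: v_def algebra_simps)
  qed
  have veq: "v * b m k = w k + (\<Sum>j<m. a j * b j k)" for k
    using eq[of k] by (simp add: v_def algebra_simps)
  have "\<exists>u\<in>R. u - 1 \<in> p \<and> (\<exists>w\<in>M. \<exists>a. (\<forall>j<m. a j \<in> p) \<and>
                (\<forall>k. u * b i k = w k + (\<Sum>j<m. a j * b j k)))" if "i < m" for i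
  proof -
    obtain u' w' a' where u': "u' \<in> R" "u' - 1 \<in> p" and w': "w' \<in> M"
      and a': "\<And>j. j < Suc m \<Longrightarrow> a' j \<in> p"
      and eq': "\<And>k. u' * b i k = w' k + (\<Sum>j<Suc m. a' j * b j k)"
      using Suc.prems[of i] \<open>i < m\<close> by (auto simp del: sum.lessThan_Suc)
    \<comment> \<open>After multiplication by \<open>v\<close>, the term in \<open>b m\<close> can
      be rewritten with \<open>veq\<close>; only the \<open>b j\<close> with \<open>j < m\<close>
      remain, with coefficients in \<open>p\<close>.\<close>
    have "v * u' * b i k = (v * w' k + a' m * w k) + (\<Sum>j<m. (v * a' j + a' m * a j) * b j k)" for k
    proof -
      have "v * u' * b i k = v * (u' * b i k)" by (simp only: mult.assoc)
      also have "\<dots> = v * w' k + v * (\<Sum>j<m. a' j * b j k) + a' m * (v * b m k)"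
        unfolding eq' by (simp add: algebra_simps)
      also have "\<dots> = v * w' k + v * (\<Sum>j<m. a' j * b j k) + a' m * (w k + (\<Sum>j<m. a j * b j k))"
        unfolding veq ..
      also have "\<dots> = (v * w' k + a' m * w k) + (\<Sum>j<m. (v * a' j + a' m * a j) * b j k)"
        by (simp add: algebra_simps sum_distrib_left sum.distrib)
      finally show ?thesis .
    qed
    moreover have "(\<lambda>k. v * w' k + a' m * w k) \<in> M"
      using a'[of m] pD(1) by (intro add smult vR w w') auto
    moreover have "\<forall>j<m. v * a' j + a' m * a j \<in> p"
      using a a' pD(1) vR by (intro allI impI pD(3) pD(4)) auto
    moreover have "v * u' \<in> R" "v * u' - 1 \<in> p" by (intro RD(5) prod1 vR v1 u')+
    ultimately show ?thesis
      by (intro bexI[of _ "v * u'"] conjI bexI[of _ "\<lambda>k. v * w' k + a' m * w k"]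
          exI[of _ "\<lambda>j. v * a' j + a' m * a j"] allI) auto
  qed
  from Suc.IH[OF this] obtain x where x: "x \<in> R" "x - 1 \<in> p" "\<And>i. i < m \<Longrightarrow> (\<lambda>k. x * b i k) \<in> M"
    by auto
  \<comment> \<open>\<open>M\<close> is only known to be closed under sums and multiples, so the
    combination is built term by term, starting from \<open>0 * w\<close>.\<close>
  have lin: "(\<lambda>k. \<Sum>j<l. a j * (x * b j k)) \<in> M" if "l \<le> m" for l
    using that
  proof (induction l)
    case 0
    show ?case using smult[OF RD(2) w] by simp
  next
    case (Suc l)
    have "(\<lambda>k. a l * (x * b l k)) \<in> M" using Suc a pD(1) by (intro smult x) auto
    with Suc show ?case using add[of "\<lambda>k. \<Sum>j<l. a j * (x * b j k)"] by simp
  qed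
  \<comment> \<open>\<open>x\<close> serves the indices below \<open>m\<close>. Since
    \<open>v * b m\<close> is \<open>w\<close> plus a combination of the earlier vectors, the
    product \<open>x * v\<close> also serves \<open>m\<close>.\<close>
  have "(\<lambda>k. x * v * b i k) \<in> M" if "i < Suc m" for i
  proof (cases "i = m")
    case True
    have "x * v * b m k = x * w k + (\<Sum>j<m. a j * (x * b j k))" for k
    proof -
      have "x * v * b m k = x * (v * b m k)" by (simp only: mult.assoc)
      also have "\<dots> = x * w k + (\<Sum>j<m. a j * (x * b j k))"
        unfolding veq by (simp add: distrib_left sum_distrib_left mult.left_commute)
      finally show ?thesis .
    qed
    then show ?thesis using add[OF smult[OF x(1) w] lin[of m]] True by simp
  next
    case False
    then have "(\<lambda>k. v * (x * b i k)) \<in> M" using that by (intro smult vR x(3)) simp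
    then show ?thesis by (simp add: mult_ac)
  qed
  then show ?case using RD(5)[OF x(1) vR] prod1[OF x(1,2) v1] by blast
qed

section \<open>The conductor of a set of elements\<close>

locale order_algebra =
  fixes R :: "'k::field_char_0 set" and n :: nat
    and c :: "nat \<Rightarrow> nat \<Rightarrow> nat \<Rightarrow> 'k" and e :: "nat \<Rightarrow> 'k"
  assumes order: "is_order R" and alg: "sc_algebra (ring_of R) n c e"
begin

abbreviation V :: "(nat \<Rightarrow> 'k) set" where
  "V \<equiv> sc_vecs (ring_of R) n"

abbreviation subalgebra :: "(nat \<Rightarrow> 'k) set \<Rightarrow> (nat \<Rightarrow> 'k) set" where
  "subalgebra G \<equiv> sc_lin (ring_of R) (sc_mons (ring_of R) n c e G)"

text \<open>This is the ideal \<open>I(G)\<close> of the introduction.\<close>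

definition conductor :: "(nat \<Rightarrow> 'k) set \<Rightarrow> 'k set" where
  "conductor G = {x \<in> R. \<forall>v\<in>V. (\<lambda>i. x * v i) \<in> subalgebra G}"

abbreviation unit_vec :: "nat \<Rightarrow> nat \<Rightarrow> 'k" where
  "unit_vec j \<equiv> (\<lambda>i. if i = j then 1 else 0)"

lemma subring: "is_subring R"
  using order by (simp add: is_order_def)

lemma c_closed: "\<forall>i<n. \<forall>j<n. \<forall>k<n. c i j k \<in> R" and e_closed: "e \<in> V"
  using alg by (simp_all add: sc_algebra_def)

lemma unit_vec_in_V: "j < n \<Longrightarrow> unit_vec j \<in> V"
  using is_subringD(1,2)[OF subring] by (auto simp: sc_vecs_ring_of)

lemma vec_expand: "v \<in> sc_vecs (ring_of S) n \<Longrightarrow> (\<Sum>j<n. v j * unit_vec j i) = v i"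
  by (auto simp: sc_vecs_ring_of if_distrib[of "\<lambda>x. _ * x"] cong: if_cong)

lemma mons_subset_V: "G \<subseteq> V \<Longrightarrow> sc_mons (ring_of R) n c e G \<subseteq> V"
  by (rule sc_mons_subset_vecs[OF cring_ring_of[OF subring]]) (use c_closed e_closed in auto)

lemma subalgebra_subset_V: "G \<subseteq> V \<Longrightarrow> subalgebra G \<subseteq> V"
  by (rule sc_lin_subset_vecs[OF cring.axioms(1)[OF cring_ring_of[OF subring]] mons_subset_V])

lemma conductorI:
  assumes x: "x \<in> R" and unit: "\<And>j. j < n \<Longrightarrow> (\<lambda>i. x * unit_vec j i) \<in> subalgebra G"
  shows "x \<in> conductor G"
  unfolding conductor_def
proof (intro CollectI conjI ballI x)
  fix v assume v: "v \<in> V"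
  have "(\<lambda>i. \<Sum>j<n. v j * (x * unit_vec j i)) \<in> subalgebra G"
    using v by (intro sc_lin_ring_of_sum sc_lin_ring_of_smult[OF subring] unit)
      (auto simp: sc_vecs_ring_of)
  also have "(\<lambda>i. \<Sum>j<n. v j * (x * unit_vec j i)) = (\<lambda>i. x * (\<Sum>j<n. v j * unit_vec j i))"
    by (simp add: sum_distrib_left mult.left_commute)
  finally show "(\<lambda>i. x * v i) \<in> subalgebra G" by (simp only: vec_expand[OF v])
qed

lemma conductor_ideal: "ring_ideal R (conductor G)"
  unfolding ring_ideal_def
proof (intro conjI ballI)
  note RD = is_subringD[OF subring]
  show "conductor G \<subseteq> R" by (auto simp: conductor_def)
  show "0 \<in> conductor G"
    using RD(2) sc_lin.zero[of "ring_of R"] by (simp add: conductor_def sc_zero_def)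
  fix x y assume "x \<in> conductor G" "y \<in> conductor G"
  then show "x + y \<in> conductor G"
    unfolding conductor_def
    by (auto simp: distrib_right intro!: RD(3) sc_lin_ring_of_add)
next
  fix a x assume a: "a \<in> R" and x: "x \<in> conductor G"
  have "(\<lambda>i. a * (x * v i)) \<in> subalgebra G" if "v \<in> V" for v
    using x that by (intro sc_lin_ring_of_smult[OF subring a]) (simp add: conductor_def)
  then show "a * x \<in> conductor G"
    using x is_subringD(5)[OF subring a] by (simp add: conductor_def mult.assoc)
qed

lemma conductor_mono: "G \<subseteq> H \<Longrightarrow> conductor G \<subseteq> conductor H"
  using sc_lin_mono[OF sc_mons_mono[of G H "ring_of R" n c e], of "ring_of R"]
  unfolding conductor_def by (auto simp: subset_iff)

text \<open>Each unit vector is a monomial of length one, its product with \<open>e\<close>. This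
  finite generating set makes all the minimal numbers of generators well defined.\<close>

lemma one_in_conductor_unit_vecs: "1 \<in> conductor (unit_vec ` {..<n})"
proof (rule conductorI)
  show "1 \<in> R" using is_subringD(1)[OF subring] .
  fix j assume j: "j < n"
  have "sc_mul (ring_of R) n c (unit_vec j) e \<in> sc_mons (ring_of R) n c e (unit_vec ` {..<n})"
    using j by (intro sc_mons.intros) auto
  also have "sc_mul (ring_of R) n c (unit_vec j) e = unit_vec j"
    using alg unit_vec_in_V[OF j] by (simp add: sc_algebra_def)
  finally show "(\<lambda>i. 1 * unit_vec j i) \<in> subalgebra (unit_vec ` {..<n})"
    using sc_lin_ring_of_base[OF subring] by simp
qed

lemma generated_iff_conductor:
  "sc_generated_by (ring_of R) n c e G \<longleftrightarrow> G \<subseteq> V \<and> 1 \<in> conductor G"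
  unfolding sc_generated_by_def conductor_def using is_subringD(1)[OF subring] by auto

lemma num_gens_le_iff:
  "sc_num_gens (ring_of R) n c e \<le> k \<longleftrightarrow>
     (\<exists>G\<subseteq>V. finite G \<and> card G \<le> k \<and> 1 \<in> conductor G)"
proof -
  have "\<exists>G. finite G \<and> sc_generated_by (ring_of R) n c e G"
    unfolding generated_iff_conductor
    using one_in_conductor_unit_vecs unit_vec_in_V
    by (intro exI[of _ "unit_vec ` {..<n}"]) auto
  from sc_num_gens_le_iff[OF this, of k] show ?thesis
    unfolding generated_iff_conductor by blast
qed

section \<open>Generation modulo a maximal ideal\<close>

text \<open>If the subalgebra is everything modulo \<open>p\<close>, Nakayama elimination on the
  unit vectors yields a conductor element that is 1 modulo \<open>p\<close>. Conversely, a conductor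
  element outside \<open>p\<close> can be inverted modulo \<open>p\<close>.\<close>

lemma spans_mod_iff_conductor:
  assumes p: "maximalideal p (ring_of R)" and G: "G \<subseteq> V"
  shows "(\<forall>v\<in>V. \<exists>m\<in>subalgebra G. \<forall>i. v i - m i \<in> p) \<longleftrightarrow> \<not> conductor G \<subseteq> p"
proof
  note p' = maximalideal_ring_idealD[OF subring p]
  note RD = is_subringD[OF subring] and pD = ring_idealD[OF p'(1)]
  assume span: "\<forall>v\<in>V. \<exists>m\<in>subalgebra G. \<forall>i. v i - m i \<in> p"
  have "\<exists>x\<in>R. x - 1 \<in> p \<and> (\<forall>i<n. (\<lambda>k. x * unit_vec i k) \<in> subalgebra G)"
  proof (rule nakayama_elimination[OF subring p'(1)])
    fix i assume i: "i < n"
    obtain m where m: "m \<in> subalgebra G" "\<forall>k. unit_vec i k - m k \<in> p"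
      using bspec[OF span unit_vec_in_V[OF i]] by (elim bexE)
    \<comment> \<open>The error of the approximation has its entries in \<open>p\<close>; expanded
      in unit vectors it supplies the relation with \<open>u = 1\<close>.\<close>
    define a where "a = (\<lambda>k. unit_vec i k - m k)"
    have "a \<in> V"
      using m unit_vec_in_V[OF i] subsetD[OF subalgebra_subset_V[OF G] m(1)] pD(1)
      unfolding a_def sc_vecs_ring_of by simp
    have "1 * unit_vec i k = m k + (\<Sum>j<n. a j * unit_vec j k)" for k
      unfolding vec_expand[OF \<open>a \<in> V\<close>] by (simp add: a_def)
    moreover have "\<forall>j<n. a j \<in> p" using m(2) by (simp add: a_def)
    ultimately show "\<exists>u\<in>R. u - 1 \<in> p \<and> (\<exists>w\<in>subalgebra G. \<exists>a. (\<forall>j<n. a j \<in> p) \<and>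
                (\<forall>k. u * unit_vec i k = w k + (\<Sum>j<n. a j * unit_vec j k)))"
      using RD(1) pD(2) m(1) by (intro bexI[of _ 1] conjI bexI[of _ m] exI[of _ a] allI) simp_all
  qed (auto intro: sc_lin_ring_of_add sc_lin_ring_of_smult[OF subring])
  then obtain x where x: "x \<in> R" "x - 1 \<in> p"
    and unit: "\<forall>i<n. (\<lambda>k. x * unit_vec i k) \<in> subalgebra G"
    by (elim bexE conjE)
  have "x \<notin> p"
  proof
    assume "x \<in> p"
    then have "x - (x - 1) \<in> p" by (intro ring_ideal_diff(2)[OF subring p'(1)] x(2))
    then show False using p'(2) by simp
  qed
  moreover have "x \<in> conductor G" using x(1) unit by (intro conductorI) auto
  ultimately show "\<not> conductor G \<subseteq> p" by blast
next
  note p' = maximalideal_ring_idealD[OF subring p]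
  assume "\<not> conductor G \<subseteq> p"
  then obtain x where x: "x \<in> conductor G" "x \<notin> p" by blast
  then have xR: "x \<in> R" by (simp add: conductor_def)
  obtain y where y: "y \<in> R" "x * y - 1 \<in> p" using p'(3)[OF xR x(2)] by blast
  show "\<forall>v\<in>V. \<exists>m\<in>subalgebra G. \<forall>i. v i - m i \<in> p"
  proof
    fix v assume v: "v \<in> V"
    have "(\<lambda>i. y * (x * v i)) \<in> subalgebra G"
      using x(1) v by (intro sc_lin_ring_of_smult[OF subring y(1)]) (simp add: conductor_def)
    moreover have "v i - y * (x * v i) \<in> p" for i
    proof -
      have "v i \<in> R" using v is_subringD(2)[OF subring] by (cases "i < n") (auto simp: sc_vecs_ring_of)
      then have "(x * y - 1) * v i \<in> p" by (rule ring_idealD(5)[OF p'(1) _ y(2)])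
      from ring_ideal_diff(1)[OF subring p'(1) this this] show ?thesis by (simp add: algebra_simps)
    qed
    ultimately show "\<exists>m\<in>subalgebra G. \<forall>i. v i - m i \<in> p"
      by (intro bexI[of _ "\<lambda>i. y * (x * v i)"] allI)
  qed
qed

lemma quotient_hom:
  assumes "maximalideal p (ring_of R)"
  shows "ring_hom_cring (ring_of R) (ring_of R Quot p) ((+>\<^bsub>ring_of R\<^esub>) p)"
    and "(+>\<^bsub>ring_of R\<^esub>) p ` carrier (ring_of R) = carrier (ring_of R Quot p)"
proof -
  interpret maximalideal p "ring_of R" by fact
  show "ring_hom_cring (ring_of R) (ring_of R Quot p) ((+>\<^bsub>ring_of R\<^esub>) p)"
    by (rule rcos_ring_hom_cring[OF cring_ring_of[OF subring]])
  show "(+>\<^bsub>ring_of R\<^esub>) p ` carrier (ring_of R) = carrier (ring_of R Quot p)"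
    by (auto simp: FactRing_def A_RCOSETS_def' a_r_coset_def)
qed

lemma quotient_generated_iff:
  assumes p: "maximalideal p (ring_of R)" and G: "G \<subseteq> V"
  shows "sc_generated_by (ring_of R Quot p) n (\<lambda>i j k. p +>\<^bsub>ring_of R\<^esub> c i j k)
      (\<lambda>k. p +>\<^bsub>ring_of R\<^esub> e k) ((\<circ>) ((+>\<^bsub>ring_of R\<^esub>) p) ` G) \<longleftrightarrow> \<not> conductor G \<subseteq> p"
proof -
  have "sc_generated_by (ring_of R Quot p) n (\<lambda>i j k. p +>\<^bsub>ring_of R\<^esub> c i j k)
      ((+>\<^bsub>ring_of R\<^esub>) p \<circ> e) ((\<circ>) ((+>\<^bsub>ring_of R\<^esub>) p) ` G) \<longleftrightarrow>
      (\<forall>v\<in>V. \<exists>m\<in>subalgebra G. (+>\<^bsub>ring_of R\<^esub>) p \<circ> v = (+>\<^bsub>ring_of R\<^esub>) p \<circ> m)"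
    using c_closed e_closed G by (intro sc_generated_by_hom_iff quotient_hom[OF p]) auto
  also have "\<dots> \<longleftrightarrow> (\<forall>v\<in>V. \<exists>m\<in>subalgebra G. \<forall>i. v i - m i \<in> p)"
    by (simp add: fun_eq_iff coset_ring_of_eq_iff[OF subring maximalideal_ring_idealD(1)[OF subring p]])
  finally show ?thesis unfolding spans_mod_iff_conductor[OF p G] by (simp add: comp_def)
qed

text \<open>Whether the conductor lies in \<open>p\<close> depends only on the residues of the
  elements modulo \<open>p\<close>, and those of \<open>H\<close> include those of \<open>G\<close>.
  This is how residues prescribed by the Chinese remainder theorem take effect.\<close>

lemma conductor_congruence:
  assumes p: "maximalideal p (ring_of R)" and G: "G \<subseteq> V" and H: "H \<subseteq> V"
    and cong: "\<And>g. g \<in> G \<Longrightarrow> \<exists>h\<in>H. \<forall>i<n. h i - g i \<in> p"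
    and "\<not> conductor G \<subseteq> p"
  shows "\<not> conductor H \<subseteq> p"
proof -
  note pI = maximalideal_ring_idealD(1)[OF subring p]
  let ?f = "(+>\<^bsub>ring_of R\<^esub>) p"
  have "(\<circ>) ?f ` G \<subseteq> (\<circ>) ?f ` H"
  proof
    fix x assume "x \<in> (\<circ>) ?f ` G"
    then obtain g where g: "g \<in> G" "x = ?f \<circ> g" by blast
    then obtain h where h: "h \<in> H" "\<forall>i<n. h i - g i \<in> p" using cong by blast
    have "h i - g i \<in> p" for i
    proof (cases "i < n")
      case False
      then have "h i = 0" "g i = 0" using g h G H by (auto simp: sc_vecs_ring_of subset_iff)
      then show ?thesis using ring_idealD(2)[OF pI] by simp
    qed (use h in simp)
    then have "?f \<circ> h = ?f \<circ> g" by (simp add: fun_eq_iff coset_ring_of_eq_iff[OF subring pI])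
    then show "x \<in> (\<circ>) ?f ` H" using g h by (metis imageI)
  qed
  moreover have "(\<circ>) ?f ` H \<subseteq> sc_vecs (ring_of R Quot p) n"
    using H unfolding sc_vecs_hom[OF quotient_hom[OF p]] by (rule image_mono)
  ultimately show ?thesis
    using assms(5)
    unfolding quotient_generated_iff[OF p G, symmetric] quotient_generated_iff[OF p H, symmetric]
    by (rule sc_generated_by_mono[rotated])
qed

lemma r_prime_le_iff:
  assumes p: "maximalideal p (ring_of R)"
  shows "r_prime R n c e p \<le> k \<longleftrightarrow>
     (\<exists>G\<subseteq>V. finite G \<and> card G \<le> k \<and> \<not> conductor G \<subseteq> p)"
proof -
  let ?f = "(+>\<^bsub>ring_of R\<^esub>) p" and ?Q = "ring_of R Quot p"
  let ?gen = "sc_generated_by ?Q n (\<lambda>i j k. ?f (c i j k)) (\<lambda>k. ?f (e k))"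
  let ?U = "unit_vec ` {..<n}"
  have U: "?U \<subseteq> V" using unit_vec_in_V by auto
  have "\<not> conductor ?U \<subseteq> p"
    using one_in_conductor_unit_vecs maximalideal_ring_idealD(2)[OF subring p] by blast
  then have "?gen ((\<circ>) ?f ` ?U)" using quotient_generated_iff[OF p U] by blast
  then have "\<exists>G. finite G \<and> ?gen G" by (intro exI[of _ "(\<circ>) ?f ` ?U"]) auto
  then have "r_prime R n c e p \<le> k \<longleftrightarrow> (\<exists>G. finite G \<and> card G \<le> k \<and> ?gen G)"
    unfolding r_prime_def by (rule sc_num_gens_le_iff)
  also have "\<dots> \<longleftrightarrow> (\<exists>G\<subseteq>V. finite G \<and> card G \<le> k \<and> \<not> conductor G \<subseteq> p)"
  proof
    assume "\<exists>G. finite G \<and> card G \<le> k \<and> ?gen G"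
    then obtain G' where G': "finite G'" "card G' \<le> k" "?gen G'" by blast
    then have "G' \<subseteq> (\<circ>) ?f ` V"
      unfolding sc_generated_by_def sc_vecs_hom[OF quotient_hom[OF p]] by blast
    \<comment> \<open>One representative is chosen per residue vector, so that lifting does not
      increase the cardinality.\<close>
    then obtain G where G: "G \<subseteq> V" "inj_on ((\<circ>) ?f) G" "G' = (\<circ>) ?f ` G"
      unfolding subset_image_inj by blast
    then have "finite G" "card G \<le> k" using G' finite_image_iff card_image by metis+
    then show "\<exists>G\<subseteq>V. finite G \<and> card G \<le> k \<and> \<not> conductor G \<subseteq> p"
      using G G'(3) quotient_generated_iff[OF p G(1)] by auto
  next
    assume "\<exists>G\<subseteq>V. finite G \<and> card G \<le> k \<and> \<not> conductor G \<subseteq> p"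
    then obtain G where G: "G \<subseteq> V" "finite G" "card G \<le> k" "\<not> conductor G \<subseteq> p" by blast
    then have "card ((\<circ>) ?f ` G) \<le> k" using card_image_le[OF G(2)] le_trans by blast
    then show "\<exists>G. finite G \<and> card G \<le> k \<and> ?gen G"
      using G quotient_generated_iff[OF p G(1)] by (intro exI[of _ "(\<circ>) ?f ` G"]) auto
  qed
  finally show ?thesis .
qed

section \<open>Generation over the number field\<close>

lemma V_subset_field: "V \<subseteq> sc_vecs (ring_of UNIV) n"
  by (auto simp: sc_vecs_ring_of)

lemma subring_UNIV: "is_subring (UNIV :: 'k set)"
  by (simp add: is_subring_def)

lemma mul_field_eq:
  assumes "u \<in> V" "v \<in> V"
  shows "sc_mul (ring_of UNIV) n c u v = sc_mul (ring_of R) n c u v"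
  using assms V_subset_field c_closed
  by (subst (1 2) sc_mul_ring_of) (auto intro: subring subring_UNIV)

lemma mons_field_eq:
  assumes G: "G \<subseteq> V"
  shows "sc_mons (ring_of UNIV) n c e G = sc_mons (ring_of R) n c e G"
proof (intro equalityI subsetI)
  fix m assume "m \<in> sc_mons (ring_of UNIV) n c e G"
  then show "m \<in> sc_mons (ring_of R) n c e G"
  proof induction
    case (mul x m)
    then have "sc_mul (ring_of UNIV) n c x m = sc_mul (ring_of R) n c x m"
      using mons_subset_V[OF G] G by (intro mul_field_eq) auto
    with mul show ?case by (simp add: sc_mons.mul)
  qed (rule sc_mons.unit)
next
  fix m assume "m \<in> sc_mons (ring_of R) n c e G"
  then show "m \<in> sc_mons (ring_of UNIV) n c e G"
  proof induction
    case (mul x m)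
    then have "sc_mul (ring_of R) n c x m = sc_mul (ring_of UNIV) n c x m"
      using mons_subset_V[OF G] G by (intro mul_field_eq[symmetric]) auto
    with mul show ?case by (simp add: sc_mons.mul)
  qed (rule sc_mons.unit)
qed

lemma lin_field_subset:
  assumes "v \<in> sc_lin (ring_of UNIV) X"
  shows "\<exists>M::int. M \<noteq> 0 \<and> (\<lambda>i. of_int M * v i) \<in> sc_lin (ring_of R) X"
  using assms
proof induction
  case zero
  show ?case using sc_lin.zero[of "ring_of R" X] by (intro exI[of _ 1]) (simp add: sc_zero_def)
next
  case (step a x v)
  then obtain M where M: "M \<noteq> 0" "(\<lambda>i. of_int M * v i) \<in> sc_lin (ring_of R) X" by blast
  obtain N where N: "N \<noteq> 0" "of_int N * a \<in> R" using is_order_fraction[OF order] by blast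
  have "of_int M * (of_int N * a) \<in> R"
    by (intro is_subringD(5)[OF subring] N is_subring_of_int[OF subring])
  then have "(\<lambda>i. of_int M * (of_int N * a) * x i + of_int N * (of_int M * v i)) \<in> sc_lin (ring_of R) X"
    by (intro sc_lin_ring_of_add sc_lin_ring_of_smult[OF subring] sc_lin_ring_of_base[OF subring step(2)]
        is_subring_of_int[OF subring] M(2))
  then show ?case using M N
    by (intro exI[of _ "M * N"]) (simp add: sc_add_def sc_smult_def algebra_simps)
qed

text \<open>Over the field each unit vector is a combination of monomials; clearing denominators
  gives a nonzero integer in the conductor. Conversely, a nonzero conductor element can be divided
  out over the field.\<close>

lemma field_generated_iff:
  assumes G: "G \<subseteq> V"
  shows "sc_generated_by (ring_of UNIV) n c e G \<longleftrightarrow> \<not> conductor G \<subseteq> {0}"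
proof
  assume gen: "sc_generated_by (ring_of UNIV) n c e G"
  have "\<exists>M::int. M \<noteq> 0 \<and> (\<lambda>i. of_int M * unit_vec j i) \<in> subalgebra G" if "j < n" for j
    using gen unit_vec_in_V[OF that] V_subset_field
    unfolding sc_generated_by_def mons_field_eq[OF G] by (intro lin_field_subset) blast
  then obtain M :: "nat \<Rightarrow> int" where M: "\<And>j. j < n \<Longrightarrow> M j \<noteq> 0"
    "\<And>j. j < n \<Longrightarrow> (\<lambda>i. of_int (M j) * unit_vec j i) \<in> subalgebra G" by metis
  \<comment> \<open>\<open>M j\<close> clears the denominators for one unit vector, the product for
    all of them.\<close>
  let ?P = "\<Prod>j<n. M j"
  have "of_int ?P \<in> conductor G"
  proof (rule conductorI[OF is_subring_of_int[OF subring]])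
    fix j assume j: "j < n"
    have "?P = (\<Prod>j\<in>{..<n} - {j}. M j) * M j"
      using j by (simp add: prod.remove[of "{..<n}" j] mult.commute)
    then have eq: "(\<lambda>i. of_int ?P * unit_vec j i) =
        (\<lambda>i. of_int (\<Prod>j\<in>{..<n} - {j}. M j) * (of_int (M j) * unit_vec j i))"
      by (simp only: of_int_mult mult.assoc)
    show "(\<lambda>i. of_int ?P * unit_vec j i) \<in> subalgebra G"
      unfolding eq by (intro sc_lin_ring_of_smult[OF subring] is_subring_of_int[OF subring] M(2) j)
  qed
  moreover have "(of_int ?P :: 'k) \<noteq> 0" using M(1) by (simp add: prod_zero_iff)
  ultimately show "\<not> conductor G \<subseteq> {0}" by blast
next
  assume "\<not> conductor G \<subseteq> {0}"
  then obtain x where x: "x \<in> conductor G" "x \<noteq> 0" by blast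
  let ?L = "sc_lin (ring_of UNIV) (sc_mons (ring_of R) n c e G)"
  have sub: "subalgebra G \<subseteq> ?L"
  proof
    fix v assume "v \<in> subalgebra G"
    then show "v \<in> ?L"
    proof induction
      case zero
      show ?case using sc_lin.zero[of "ring_of UNIV"] by (simp add: sc_zero_def)
    next
      case (step a y v)
      then show ?case using sc_lin.step[of a "ring_of UNIV" y] by (simp add: sc_add_def sc_smult_def)
    qed
  qed
  have "v \<in> ?L" if v: "v \<in> sc_vecs (ring_of UNIV) n" for v
  proof -
    have unit: "(\<lambda>i. x * unit_vec j i) \<in> ?L" if "j < n" for j
      using x(1) unit_vec_in_V[OF that] by (intro subsetD[OF sub]) (simp add: conductor_def)
    have "(\<lambda>i. \<Sum>j<n. (v j / x) * (x * unit_vec j i)) \<in> ?L"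
      by (intro sc_lin_ring_of_sum sc_lin_ring_of_smult[OF subring_UNIV] unit) auto
    also have "(\<lambda>i. \<Sum>j<n. (v j / x) * (x * unit_vec j i)) = (\<lambda>i. \<Sum>j<n. v j * unit_vec j i)"
      using x(2) by (simp add: mult.assoc[symmetric])
    finally show ?thesis by (simp only: vec_expand[OF v])
  qed
  then show "sc_generated_by (ring_of UNIV) n c e G"
    unfolding sc_generated_by_def mons_field_eq[OF G] using G V_subset_field by blast
qed

text \<open>Scaling the generators changes monomials only by scalars invertible in the field. The
  lemma serves to move generators over the field into \<open>V\<close>.\<close>

lemma field_generated_rescale:
  assumes G: "sc_generated_by (ring_of UNIV) n c e G" and N: "N \<noteq> 0"
  shows "sc_generated_by (ring_of UNIV) n c e ((\<lambda>g i. N * g i) ` G)"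
proof -
  let ?K = "ring_of (UNIV :: 'k set)" and ?H = "(\<lambda>g i. N * g i) ` G"
  have GV: "G \<subseteq> sc_vecs ?K n" using G by (simp add: sc_generated_by_def)
  then have HV: "?H \<subseteq> sc_vecs ?K n" by (auto simp: sc_vecs_ring_of subset_iff)
  have eV: "e \<in> sc_vecs ?K n" using e_closed V_subset_field by blast
  have mons: "sc_mons ?K n c e H \<subseteq> sc_vecs ?K n" if "H \<subseteq> sc_vecs ?K n" for H
    by (rule sc_mons_subset_vecs[OF cring_ring_of[OF subring_UNIV] _ eV that]) simp
  have scale: "\<exists>a. \<exists>m'\<in>sc_mons ?K n c e ?H. m = (\<lambda>i. a * m' i)" if "m \<in> sc_mons ?K n c e G" for m
    using that
  proof induction
    case unit
    show ?case by (intro exI[of _ 1] bexI[of _ e] sc_mons.unit) simp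
  next
    case (mul x m)
    then obtain a m' where m': "m' \<in> sc_mons ?K n c e ?H" "m = (\<lambda>i. a * m' i)" by blast
    have V: "x \<in> sc_vecs ?K n" "m \<in> sc_vecs ?K n" "(\<lambda>i. N * x i) \<in> sc_vecs ?K n" "m' \<in> sc_vecs ?K n"
      using mul GV HV mons[OF GV] mons[OF HV] m'(1) by blast+
    have "sc_mul ?K n c x m = (\<lambda>i. (a / N) * sc_mul ?K n c (\<lambda>i. N * x i) m' i)"
      unfolding sc_mul_ring_of[OF subring_UNIV _ V(1,2), of c, simplified]
        sc_mul_ring_of[OF subring_UNIV _ V(3,4), of c, simplified]
      using N by (auto simp: m'(2) fun_eq_iff sum_distrib_left sum_divide_distrib mult_ac intro!: sum.cong)
    moreover have "sc_mul ?K n c (\<lambda>i. N * x i) m' \<in> sc_mons ?K n c e ?H"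
      using mul(1) m'(1) by (intro sc_mons.mul) auto
    ultimately show ?case by blast
  qed
  have "v \<in> sc_lin ?K (sc_mons ?K n c e ?H)" if "v \<in> sc_lin ?K (sc_mons ?K n c e G)" for v
    using that
  proof induction
    case zero
    show ?case by (rule sc_lin.zero)
  next
    case (step b x v)
    obtain a m' where m': "m' \<in> sc_mons ?K n c e ?H" "x = (\<lambda>i. a * m' i)" using scale[OF step(2)] by blast
    have "sc_add ?K (sc_smult ?K (b * a) m') v \<in> sc_lin ?K (sc_mons ?K n c e ?H)"
      using m' step by (intro sc_lin.step) auto
    then show ?case by (simp add: sc_add_def sc_smult_def m'(2) mult.assoc)
  qed
  then show ?thesis using G HV unfolding sc_generated_by_def by blast
qed

text \<open>Finitely many generators over the field have finitely many coordinates; multiplying by a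
  common denominator brings them into \<open>V\<close>, where \<open>field_generated_iff\<close>
  applies.\<close>

lemma r_zero_le_iff:
  "r_zero n c e \<le> k \<longleftrightarrow> (\<exists>G\<subseteq>V. finite G \<and> card G \<le> k \<and> \<not> conductor G \<subseteq> {0})"
proof -
  let ?gen = "sc_generated_by (ring_of UNIV) n c e"
  let ?U = "unit_vec ` {..<n}"
  have U: "?U \<subseteq> V" using unit_vec_in_V by auto
  have "\<not> conductor ?U \<subseteq> {0}" using one_in_conductor_unit_vecs by force
  then have "\<exists>G. finite G \<and> ?gen G"
    using field_generated_iff[OF U] by (intro exI[of _ ?U]) auto
  then have "r_zero n c e \<le> k \<longleftrightarrow> (\<exists>G. finite G \<and> card G \<le> k \<and> ?gen G)"
    unfolding r_zero_def by (rule sc_num_gens_le_iff)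
  also have "\<dots> \<longleftrightarrow> (\<exists>G\<subseteq>V. finite G \<and> card G \<le> k \<and> \<not> conductor G \<subseteq> {0})"
  proof
    assume "\<exists>G. finite G \<and> card G \<le> k \<and> ?gen G"
    then obtain G where G: "finite G" "card G \<le> k" "?gen G" by blast
    have "finite ((\<lambda>(g, i). g i) ` (G \<times> {..<n}))" using G(1) by simp
    then obtain N :: int where N: "N \<noteq> 0" "\<forall>x\<in>(\<lambda>(g, i). g i) ` (G \<times> {..<n}). of_int N * x \<in> R"
      using is_order_fractions[OF order] by blast
    let ?H = "(\<lambda>g i. of_int N * g i) ` G"
    have H: "?H \<subseteq> V"
      using N(2) G(3) by (auto simp: sc_generated_by_def sc_vecs_ring_of subset_iff)
    have "?gen ?H" using N(1) by (intro field_generated_rescale[OF G(3)]) simp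
    then have "\<not> conductor ?H \<subseteq> {0}" using field_generated_iff[OF H] by blast
    moreover have "card ?H \<le> k" using card_image_le[OF G(1)] G(2) le_trans by blast
    ultimately show "\<exists>G\<subseteq>V. finite G \<and> card G \<le> k \<and> \<not> conductor G \<subseteq> {0}"
      using H G(1) by (intro exI[of _ ?H]) auto
  qed (use field_generated_iff in blast)
  finally show ?thesis .
qed

section \<open>Choosing the generators one at a time\<close>

text \<open>\<open>A\<close> holds the elements chosen so far and grows during the induction. Over
  the field \<open>m\<close> further elements suffice, while \<open>Suc m\<close> are allowed modulo
  each \<open>p\<close> and in the conclusion; this surplus of one drives the induction.\<close>

lemma completion_at_all_maximalideals:
  assumes "finite A" "A \<subseteq> V"
    and "\<exists>H\<subseteq>V. finite H \<and> card H \<le> m \<and> \<not> conductor (A \<union> H) \<subseteq> {0}"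
    and "\<And>p. maximalideal p (ring_of R) \<Longrightarrow>
           \<exists>H\<subseteq>V. finite H \<and> card H \<le> Suc m \<and> \<not> conductor (A \<union> H) \<subseteq> p"
  shows "\<exists>G\<subseteq>V. finite G \<and> card G \<le> Suc m \<and> 1 \<in> conductor (A \<union> G)"
  using assms
proof (induction m arbitrary: A)
  have split: "\<exists>t\<in>V. \<exists>H'\<subseteq>V. finite H' \<and> card H' \<le> m \<and> H \<subseteq> insert t H'"
    if "H \<subseteq> V" "finite H" "card H \<le> Suc m" for H m
  proof (cases "H = {}")
    case True
    \<comment> \<open>An empty \<open>H\<close> has no element to split off, so \<open>e\<close>
      serves as a dummy.\<close>
    then show ?thesis using e_closed by (intro bexI[of _ e] exI[of _ "{}"]) auto
  next
    case False
    then obtain t where "t \<in> H" by blast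
    then show ?thesis using that by (intro bexI[of _ t] exI[of _ "H - {t}"]) auto
  qed
  {
    case 0
    \<comment> \<open>With no elements left to add over the field, \<open>A\<close> itself generates
      there, hence also modulo every \<open>p\<close> that does not contain
      \<open>d\<close>.\<close>
    then have "\<not> conductor A \<subseteq> {0}" by auto
    then obtain d where d: "d \<in> conductor A" "d \<noteq> 0" by blast
    have dR: "d \<in> R" using d by (simp add: conductor_def)
    let ?P = "{p. maximalideal p (ring_of R) \<and> d \<in> p}"
    have finP: "finite ?P" by (rule finite_maximalideals_containing[OF order dR d(2)])
    have "\<exists>t\<in>V. \<not> conductor (insert t A) \<subseteq> p" if p: "maximalideal p (ring_of R)" for p
    proof -
      obtain H where H: "H \<subseteq> V" "finite H" "card H \<le> Suc 0" "\<not> conductor (A \<union> H) \<subseteq> p"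
        using "0.prems"(4)[OF p] by blast
      obtain t H' where t: "t \<in> V" "finite H'" "card H' \<le> 0" "H \<subseteq> insert t H'"
        using split[OF H(1-3)] by blast
      then have "A \<union> H \<subseteq> insert t A" by auto
      then show ?thesis using conductor_mono H(4) t(1) by blast
    qed
    then obtain t where t: "\<And>p. maximalideal p (ring_of R) \<Longrightarrow> t p \<in> V"
      "\<And>p. maximalideal p (ring_of R) \<Longrightarrow> \<not> conductor (insert (t p) A) \<subseteq> p" by metis
    have "\<exists>u\<in>V. \<forall>p\<in>?P. \<forall>i<n. u i - t p i \<in> p"
      by (rule maximalideal_crt[OF subring finP]) (use t(1) in auto)
    then obtain u where u: "u \<in> V" "\<forall>p\<in>?P. \<forall>i<n. u i - t p i \<in> p" by (elim bexE)
    have local: "\<not> conductor (insert u A) \<subseteq> p" if p: "maximalideal p (ring_of R)" for p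
    proof (cases "d \<in> p")
      case True
      show ?thesis
      proof (rule conductor_congruence[OF p _ _ _ t(2)[OF p]])
        fix g assume g: "g \<in> insert (t p) A"
        show "\<exists>h\<in>insert u A. \<forall>i<n. h i - g i \<in> p"
        proof (cases "g = t p")
          case True
          then show ?thesis using bspec[OF u(2), of p] p \<open>d \<in> p\<close> by (intro bexI[of _ u]) simp_all
        next
          case False
          then show ?thesis using g ring_idealD(2)[OF maximalideal_ring_idealD(1)[OF subring p]]
            by (intro bexI[of _ g]) auto
        qed
      qed (use t(1)[OF p] u(1) \<open>A \<subseteq> V\<close> in auto)
    next
      case False
      then show ?thesis using d conductor_mono[of A "insert u A"] by blast
    qed
    \<comment> \<open>An ideal contained in no maximal ideal is the whole ring.\<close>
    have "1 \<in> conductor (insert u A)"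
    proof (rule ccontr)
      assume "1 \<notin> conductor (insert u A)"
      with conductor_ideal obtain p where "maximalideal p (ring_of R)" "conductor (insert u A) \<subseteq> p"
        by (rule exists_maximalideal[OF subring])
      then show False using local by blast
    qed
    then show ?case using u(1) by (intro exI[of _ "{u}"]) auto
  next
    case (Suc m)
    obtain H where H: "H \<subseteq> V" "finite H" "card H \<le> Suc m" "\<not> conductor (A \<union> H) \<subseteq> {0}"
      using Suc.prems(3) by blast
    obtain d where d: "d \<in> conductor (A \<union> H)" "d \<noteq> 0" using H(4) by blast
    have dR: "d \<in> R" using d by (simp add: conductor_def)
    obtain b H' where b: "b \<in> V" "H' \<subseteq> V" "finite H'" "card H' \<le> m" "H \<subseteq> insert b H'"
      using split[OF H(1-3)] by blast
    let ?P = "{p. maximalideal p (ring_of R) \<and> d \<in> p}"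
    have finP: "finite ?P" by (rule finite_maximalideals_containing[OF order dR d(2)])
    \<comment> \<open>At \<open>q\<close> the set \<open>H\<close> still completes \<open>A\<close>.
      As \<open>q\<close> is not in \<open>?P\<close>, congruence to \<open>b\<close> there can be
      imposed together with the conditions at the members of \<open>?P\<close>.\<close>
    obtain q where q: "maximalideal q (ring_of R)" "d \<notin> q"
      using exists_maximalideal_avoiding[OF order dR d(2)] .
    define ok where "ok p t \<longleftrightarrow>
        (\<exists>C\<subseteq>V. finite C \<and> card C \<le> Suc m \<and> \<not> conductor (insert t A \<union> C) \<subseteq> p)" for p t
    have "\<exists>t\<in>V. ok p t" if p: "maximalideal p (ring_of R)" for p
    proof -
      obtain H where H: "H \<subseteq> V" "finite H" "card H \<le> Suc (Suc m)" "\<not> conductor (A \<union> H) \<subseteq> p"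
        using Suc.prems(4)[OF p] by blast
      obtain t H' where t: "t \<in> V" "H' \<subseteq> V" "finite H'" "card H' \<le> Suc m" "H \<subseteq> insert t H'"
        using split[OF H(1-3)] by blast
      then have "A \<union> H \<subseteq> insert t A \<union> H'" by auto
      then have "\<not> conductor (insert t A \<union> H') \<subseteq> p" using conductor_mono H(4) by blast
      then show ?thesis unfolding ok_def using t by blast
    qed
    then obtain t where t: "\<And>p. maximalideal p (ring_of R) \<Longrightarrow> t p \<in> V"
      and ok: "\<And>p. maximalideal p (ring_of R) \<Longrightarrow> ok p (t p)" by metis
    have "\<exists>u\<in>V. \<forall>p\<in>insert q ?P. \<forall>i<n. u i - (if p = q then b else t p) i \<in> p"
      by (rule maximalideal_crt[OF subring]) (use finP t b(1) q(1) in auto)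
    then obtain u where u: "u \<in> V" "\<forall>p\<in>insert q ?P. \<forall>i<n. u i - (if p = q then b else t p) i \<in> p"
      by (elim bexE)
    have transfer: "\<not> conductor (insert u A \<union> D) \<subseteq> p"
      if p: "maximalideal p (ring_of R)" and s: "s \<in> V" "\<And>i. i < n \<Longrightarrow> u i - s i \<in> p"
        and D: "D \<subseteq> V" "\<not> conductor (insert s A \<union> D) \<subseteq> p" for p s D
    proof (rule conductor_congruence[OF p _ _ _ D(2)])
      fix g assume g: "g \<in> insert s A \<union> D"
      show "\<exists>h\<in>insert u A \<union> D. \<forall>i<n. h i - g i \<in> p"
      proof (cases "g = s")
        case True
        then show ?thesis using s(2) by (intro bexI[of _ u]) auto
      next
        case False
        then show ?thesis using g ring_idealD(2)[OF maximalideal_ring_idealD(1)[OF subring p]]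
          by (intro bexI[of _ g]) auto
      qed
    qed (use s(1) u(1) D(1) \<open>A \<subseteq> V\<close> in auto)
    have "\<exists>G\<subseteq>V. finite G \<and> card G \<le> Suc m \<and> 1 \<in> conductor (insert u A \<union> G)"
    proof (rule Suc.IH)
      show "finite (insert u A)" "insert u A \<subseteq> V" using Suc.prems u(1) by auto
      \<comment> \<open>Generation over K is inherited from generation modulo q, where u is congruent to b.\<close>
      have "\<not> conductor (insert b A \<union> H') \<subseteq> q"
        using conductor_mono[of "A \<union> H" "insert b A \<union> H'"] b(5) d(1) q(2) by blast
      then have "\<not> conductor (insert u A \<union> H') \<subseteq> q"
        using bspec[OF u(2), of q] by (intro transfer[OF q(1) b(1) _ b(2)]) simp_all
      then have "\<not> conductor (insert u A \<union> H') \<subseteq> {0}"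
        using ring_idealD(2)[OF maximalideal_ring_idealD(1)[OF subring q(1)]] by blast
      then show "\<exists>H\<subseteq>V. finite H \<and> card H \<le> m \<and> \<not> conductor (insert u A \<union> H) \<subseteq> {0}"
        using b by blast
    next
      fix p assume p: "maximalideal p (ring_of R)"
      show "\<exists>H\<subseteq>V. finite H \<and> card H \<le> Suc m \<and> \<not> conductor (insert u A \<union> H) \<subseteq> p"
      proof (cases "d \<in> p")
        case True
        then have "p \<noteq> q" using q(2) by blast
        obtain C where C: "C \<subseteq> V" "finite C" "card C \<le> Suc m" "\<not> conductor (insert (t p) A \<union> C) \<subseteq> p"
          using ok[OF p] unfolding ok_def by blast
        have "\<not> conductor (insert u A \<union> C) \<subseteq> p"
          using bspec[OF u(2), of p] p True \<open>p \<noteq> q\<close>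
          by (intro transfer[OF p t[OF p] _ C(1,4)]) simp_all
        then show ?thesis using C by blast
      next
        case False
        \<comment> \<open>Here the surplus is used: the old completion \<open>H\<close> is kept
          whole, since its \<open>Suc m\<close> elements are allowed modulo \<open>p\<close> even
          after \<open>u\<close> has been added.\<close>
        then have "\<not> conductor (insert u A \<union> H) \<subseteq> p"
          using d(1) conductor_mono[of "A \<union> H" "insert u A \<union> H"] by blast
        then show ?thesis using H by blast
      qed
    qed
    then obtain G where G: "G \<subseteq> V" "finite G" "card G \<le> Suc m" "1 \<in> conductor (insert u A \<union> G)" by blast
    then have "card (insert u G) \<le> Suc (Suc m)" by (simp add: card_insert_if)
    then show ?case using G u(1) by (intro exI[of _ "insert u G"]) auto
  }
qed

text \<open>The construction starts from the empty set with \<open>k = Suc m\<close>; the strict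
  inequality leaves \<open>m\<close> elements enough over the field.\<close>

lemma num_gens_le:
  assumes "r_zero n c e < k" and "\<And>p. maximalideal p (ring_of R) \<Longrightarrow> r_prime R n c e p \<le> k"
  shows "sc_num_gens (ring_of R) n c e \<le> k"
proof -
  obtain m where m: "k = Suc m" "r_zero n c e \<le> m" using assms(1) by (cases k) auto
  have "\<exists>G\<subseteq>V. finite G \<and> card G \<le> Suc m \<and> 1 \<in> conductor ({} \<union> G)"
  proof (rule completion_at_all_maximalideals)
    show "\<exists>H\<subseteq>V. finite H \<and> card H \<le> m \<and> \<not> conductor ({} \<union> H) \<subseteq> {0}"
      using m(2) unfolding r_zero_le_iff by simp
    show "\<exists>H\<subseteq>V. finite H \<and> card H \<le> Suc m \<and> \<not> conductor ({} \<union> H) \<subseteq> p"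
      if p: "maximalideal p (ring_of R)" for p
      using assms(2)[OF p] unfolding m(1) r_prime_le_iff[OF p] by simp
  qed auto
  then show ?thesis unfolding num_gens_le_iff m(1) by simp
qed

lemma r_prime_le_num_gens:
  assumes p: "maximalideal p (ring_of R)"
  shows "r_prime R n c e p \<le> sc_num_gens (ring_of R) n c e"
proof -
  obtain G where "G \<subseteq> V" "finite G" "card G \<le> sc_num_gens (ring_of R) n c e" "1 \<in> conductor G"
    using num_gens_le_iff[of "sc_num_gens (ring_of R) n c e"] by auto
  then show ?thesis
    unfolding r_prime_le_iff[OF p] using maximalideal_ring_idealD(2)[OF subring p]
    by (intro exI[of _ G]) auto
qed

lemma r_zero_le_num_gens: "r_zero n c e \<le> sc_num_gens (ring_of R) n c e"
proof -
  obtain G where "G \<subseteq> V" "finite G" "card G \<le> sc_num_gens (ring_of R) n c e" "1 \<in> conductor G"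
    using num_gens_le_iff[of "sc_num_gens (ring_of R) n c e"] by auto
  then show ?thesis
    unfolding r_zero_le_iff by (intro exI[of _ G]) auto
qed

end

theorem mainTheorem4:
  fixes R :: "'k::field_char_0 set"
    and n :: nat and c :: "nat \<Rightarrow> nat \<Rightarrow> nat \<Rightarrow> 'k" and e :: "nat \<Rightarrow> 'k"
  assumes "is_number_field TYPE('k)"
    and "is_order R"
    and "sc_algebra (ring_of R) n c e"
  shows "((\<exists>p. maximalideal p (ring_of R) \<and> r_zero n c e < r_prime R n c e p) \<longrightarrow>
            sc_num_gens (ring_of R) n c e = Max {r_prime R n c e p | p. maximalideal p (ring_of R)})
       \<and> ((\<forall>p. maximalideal p (ring_of R) \<longrightarrow> r_zero n c e = r_prime R n c e p) \<longrightarrow>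
            r_zero n c e \<le> sc_num_gens (ring_of R) n c e \<and>
            sc_num_gens (ring_of R) n c e \<le> r_zero n c e + 1)"
proof -
  interpret order_algebra R n c e using assms(2,3) by unfold_locales
  let ?r = "sc_num_gens (ring_of R) n c e"
  let ?M = "{r_prime R n c e p | p. maximalideal p (ring_of R)}"
  have le: "x \<le> ?r" if "x \<in> ?M" for x using that r_prime_le_num_gens by blast
  \<comment> \<open>There may be infinitely many \<open>p\<close>, but all the values are bounded by
    \<open>?r\<close>, so \<open>Max\<close> is meaningful.\<close>
  then have fin: "finite ?M" by (intro finite_subset[of ?M "{..?r}"]) auto
  show ?thesis
  proof (intro conjI impI)
    assume "\<exists>p. maximalideal p (ring_of R) \<and> r_zero n c e < r_prime R n c e p"
    then obtain p where p: "r_prime R n c e p \<in> ?M" "r_zero n c e < r_prime R n c e p" by blast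
    show "?r = Max ?M"
    proof (rule antisym)
      \<comment> \<open>The strict inequality at a single \<open>p\<close> makes
        \<open>k = Max ?M\<close> admissible in \<open>num_gens_le\<close>.\<close>
      have "r_zero n c e < Max ?M" using p Max_ge[OF fin p(1)] by linarith
      then show "?r \<le> Max ?M" using Max_ge[OF fin] by (intro num_gens_le) auto
      show "Max ?M \<le> ?r" using le p(1) by (subst Max_le_iff[OF fin]) auto
    qed
  next
    assume "\<forall>p. maximalideal p (ring_of R) \<longrightarrow> r_zero n c e = r_prime R n c e p"
    \<comment> \<open>Without a strict inequality at any \<open>p\<close>, the surplus has to be
      paid for by taking \<open>k\<close> to be one more than \<open>r_zero\<close>.\<close>
    then show "?r \<le> r_zero n c e + 1" by (intro num_gens_le) auto
  qed (rule r_zero_le_num_gens)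
qed

end
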